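(* Consider any instance of the partitioned Kuramoto model described in the context (parts $\mathcal M_1,\dots,\mathcal M_m,\mathcal C_1,\dots,\mathcal C_c,\mathcal P$). For $\tau\in\{1,\dots,m\}$ let $\boldsymbol\mu_\tau\in\mathbb R^N$ be the vector with $j$-th entry $\mu_{\tau j}$ for $j\in\mathcal M_\tau$ and $0$ for $j\notin\mathcal M_\tau$, and let $\tilde\omega_\tau=\boldsymbol\mu_\tau^\top\boldsymbol\omega$; if $m\ge2$, suppose $(\tilde\omega_1,\dots,\tilde\omega_m)\ne(0,\dots,0)$. For $\eta\in\{1,\dots,m-1\}$ let $\boldsymbol\nu_\eta=\tilde\omega_{\eta+1}\boldsymbol\mu_\eta-\tilde\omega_\eta\boldsymbol\mu_{\eta+1}$. Let $\mathcal M=\bigcup_\tau\mathcal M_\tau$, $j_\eta=\max\mathcal M_\eta$ for $\eta\in\{1,\dots,m-1\}$, and $\mathcal I=\{j_1,\dots,j_{m-1}\}$. Consider the linear change of coordinates on $\mathbb R^{\mathcal M}$ given by $\phi_j=\theta_j$ for $j\in\mathcal M\setminus\mathcal I$ and $\phi_{j_\eta}=\boldsymbol\nu_\eta^\top\boldsymbol\theta$ for $\eta\in\{1,\dots,m-1\}$; let $V=(V_{jk})_{j,k\in\mathcal M}$ be its matrix and $V^{-1}$ the inverse matrix. Let $\boldsymbol\theta=(\theta_1,\dots,\theta_N):I\to\mathbb R^N$ be a solution of the Kuramoto equations on an open interval $I\ni 0$ and put $z_j=e^{i\theta_j}$. Set $\xi_j=e^{i\phi_j}$ for $j\in\mathcal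 M\setminus\mathcal I$, and $$\kappa_\eta=\sum_{\varepsilon=1}^{m-1}V^{-1}_{j_\eta,j_\varepsilon}\,\boldsymbol\nu_\varepsilon^\top\boldsymbol\theta(0),\qquad \xi^{\boldsymbol v_\eta}=\prod_{\ell\in\mathcal M\setminus\mathcal I}\xi_\ell^{V^{-1}_{j_\eta,\ell}}:=\exp\Big(i\sum_{\ell\in\mathcal M\setminus\mathcal I}V^{-1}_{j_\eta,\ell}\,\phi_\ell\Big),\qquad \eta\in\{1,\dots,m-1\}.$$ For each $\gamma\in\{1,\dots,c\}$ choose constants $w_j\in\mathbb C$ with $|w_j|=1$ ($j\in\mathcal C_\gamma$), $Z_\gamma^0\in\mathbb D$ and $\zeta_\gamma^0$ with $|\zeta_\gamma^0|=1$ such that $z_j(0)=M_{Z_\gamma^0,\zeta_\gamma^0}(w_j)$ for all $j\in\mathcal C_\gamma$, where $M_{Z,\zeta}(w)=\dfrac{\zeta w+Z}{1+\zeta\overline Z w}$. Then there are differentiable functions $Z_\gamma:I\to\mathbb D$ and $\zeta_\gamma:I\to\{|\zeta|=1\}$, with $Z_\gamma(0)=Z_\gamma^0$ and $\zeta_\gamma(0)=\zeta_\gamma^0$ ($\gamma\in\{1,\dots,c\}$), such that on $I$ $$z_j=M_{Z_\gamma,\zeta_\gamma}(w_j)\ (j\in\mathcal C_\gamma,\ 1\le\gamma\le c),\qquad z_{j_\eta}=e^{i\kappa_\eta}\xi^{\boldsymbol v_\eta}\ (1\le\eta\le m-1),\qquad z_j=\xi_j\ (j\in\mathcal M\setminus\mathcal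 I),$$ the quantities $\phi_{j_\eta}=\boldsymbol\nu_\eta^\top\boldsymbol\theta$ are constant in time, and $(\xi_j)_{j\in\mathcal M\setminus\mathcal I}$, $(Z_\gamma,\zeta_\gamma)_{\gamma}$, $(z_j)_{j\in\mathcal P}$ satisfy the closed system: (monomial parts) for $\eta\in\{1,\dots,m-1\}$ and $j\in\mathcal M_\eta\setminus\{j_\eta\}$, $$\dot\xi_j=i\omega_j\xi_j+\frac1{2\mu_{\eta j}}\sum_{k\in\mathcal M_\eta\setminus\{j_\eta\}}S_{jk}\big(\xi_ke^{-i\kappa_{jk}}-\overline{\xi_k}\,\xi_j^2e^{i\kappa_{jk}}\big)+\frac{1}{2\mu_{\eta j}}S_{jj_\eta}\big(\xi^{\boldsymbol v_\eta}e^{i(\kappa_\eta-\kappa_{jj_\eta})}-\overline{\xi^{\boldsymbol v_\eta}}\,\xi_j^2e^{-i(\kappa_\eta-\kappa_{jj_\eta})}\big),$$ and for $j\in\mathcal M_m$, $$\dot\xi_j=i\omega_j\xi_j+\frac1{2\mu_{mj}}\sum_{k\in\mathcal M_m}S_{jk}\big(\xi_ke^{-i\kappa_{jk}}-\overline{\xi_k}\,\xi_j^2e^{i\kappa_{jk}}\big);$$ (cross-ratio parts) for $\gamma\in\{1,\dots,c\}$, $$\dot Z_\gamma=F_\gamma+i\Omega_\gamma Z_\gamma-\overline{F_\gamma}Z_\gamma^2,\qquad \dot\zeta_\gamma=\big(i\Omega_\gamma+F_\gamma\overline{Z_\gamma}-\overline{F_\gamma}Z_\gamma\big)\zeta_\gamma,$$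 $$F_\gamma=\sum_{k\in\mathcal M\setminus\mathcal I}\mathcal A_{\gamma k}\xi_k+\sum_{\varepsilon=1}^{m-1}\mathcal A_{\gamma j_\varepsilon}e^{i\kappa_\varepsilon}\xi^{\boldsymbol v_\varepsilon}+\sum_{\delta=1}^c\sum_{k\in\mathcal C_\delta}\mathcal A_{\gamma k}M_{Z_\delta,\zeta_\delta}(w_k)+\sum_{k\in\mathcal P}\mathcal A_{\gamma k}z_k;$$ (non-integrable part) for $j\in\mathcal P$, $$\dot z_j=G_j-\overline{G_j}z_j^2,\qquad G_j=\sum_{k\in\mathcal M\setminus\mathcal I}A_{jk}\xi_k+\sum_{\varepsilon=1}^{m-1}A_{jj_\varepsilon}e^{i\kappa_\varepsilon}\xi^{\boldsymbol v_\varepsilon}+\sum_{\delta=1}^c\sum_{k\in\mathcal C_\delta}A_{jk}M_{Z_\delta,\zeta_\delta}(w_k)+\sum_{k\in\mathcal P}A_{jk}z_k.$$ Thus the $N=\sum_{\tau=1}^m d_\tau+\sum_{\gamma=1}^c n_\gamma+p$ real Kuramoto equations are reduced to a system of real dimension $$n=\sum_{\tau=1}^{m-1}(d_\tau-1)+d_m+3c+p,$$ and there are $$q=N-n=(m-1)+\sum_{\gamma=1}^c(n_\gamma-3)$$ functionally independent constants of motion. If there are no monomial parts ($m=0$), the same holds with $\mathcal M=\mathcal I=\emptyset$, the monomial equations and all terms in $\xi$ absent, $n=3c+p$ and $q=\sum_{\gamma=1}^c(n_\gamma-3)$.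
   Context: Notation: $\mathbb D$ is the open unit disk in $\mathbb C$, the bar is complex conjugation, $\mathcal V=\{1,\dots,N\}$, $\boldsymbol\omega=(\omega_1,\dots,\omega_N)^\top$. A constant of motion is a function of the state that is constant along every solution. Partitioned Kuramoto model. Let $m,c,p\ge0$ be integers (empty sums are zero). The vertex set $\mathcal V$ is partitioned into $\mathcal M_1,\dots,\mathcal M_m$ with $|\mathcal M_\tau|=d_\tau\ge1$, $\mathcal C_1,\dots,\mathcal C_c$ with $|\mathcal C_\gamma|=n_\gamma\ge4$, and $\mathcal P$ with $|\mathcal P|=p$. The Kuramoto equations are $$\dot\theta_j=\omega_j+\sum_{k\in\mathcal V}W_{jk}\sin(\theta_k-\theta_j-\alpha_{jk}),\qquad j\in\mathcal V,$$ with real $\omega_j,W_{jk}$, with $-\pi/2<\alpha_{jk}\le\pi/2$, and $W_{jj}=\alpha_{jj}=0$ for all $j$. With $z_j=e^{i\theta_j}$ they read $\dot z_j=\sum_kA_{jk}z_k-\big(\sum_k\overline{A_{jk}}\,\overline{z_k}\big)z_j^2$, where $A_{jk}=\tfrac12W_{jk}e^{-i\alpha_{jk}}$ for $j\ne k$ and $A_{jj}=\tfrac i2\omega_j$. The parameters have the following structure. (i) Rows $j\in\mathcal M_\tau$: there are nonzero reals $\mu_{\tau j}$ ($j\in\mathcal M_\tau$), reals $S_{jk}=S_{kj}$ and reals $\kappa_{jk}=-\kappa_{kj}$ with $|\kappa_{jk}|<\pi/2$ ($j,k\in\mathcal M_\tau$), with $S_{jj}=0$, such that $W_{jk}=S_{jk}/\mu_{\tau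 j}$ and $\alpha_{jk}=\kappa_{jk}$ for $k\in\mathcal M_\tau$, and $W_{jk}=0$, $\alpha_{jk}=0$ for $k\notin\mathcal M_\tau$. The $\omega_j$ are real. (ii) Rows $j\in\mathcal C_\gamma$: there are reals $C_{k\gamma}$ and $\chi_{k\gamma}$ with $|\chi_{k\gamma}|<\pi/2$ ($k\in\mathcal V$) such that $W_{jk}=C_{k\gamma}$ and $\alpha_{jk}=\chi_{k\gamma}$ for all $k\ne j$. Put $\mathcal A_{\gamma k}=\tfrac12C_{k\gamma}e^{-i\chi_{k\gamma}}$ for all $k\in\mathcal V$. For a fixed reference index $\ell_\gamma\in\mathcal C_\gamma$, $\omega_{\ell_\gamma}$ is an arbitrary real and $\omega_j=\omega_{\ell_\gamma}+2\,\mathrm{Im}(\mathcal A_{\gamma j}-\mathcal A_{\gamma\ell_\gamma})$ for $j\in\mathcal C_\gamma$. Put $\Omega_\gamma=\omega_{\ell_\gamma}-2\,\mathrm{Im}(\mathcal A_{\gamma\ell_\gamma})$. (iii) Rows $j\in\mathcal P$: $W_{jk},\alpha_{jk}$ ($k\neq j$) and $\omega_j$ are arbitrary (within the ranges above). The entries may be random; the statement concerns every fixed instance.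
   Formalization: The reduced-system part assumes that V is invertible, i.e. that ω̃_2,…,ω̃_m are all nonzero; the stated condition (ω̃_1,…,ω̃_m)≠0 does not ensure that V^{-1} exists. Conservation of ν_η^⊤θ, the dimension counts and the q independent constants are proved without this. *)

theory Defs
  imports "HOL-Analysis.Analysis"
begin

section \<open>Partitioned Kuramoto model\<close>

text \<open>
  The vertex set \<open>{1,\<dots>,N}\<close> is a finite linearly ordered type \<open>'n\<close>, with \<open>N = CARD('n)\<close>.
  The parts are numbered from 1.  Since distinct parts are disjoint, the matrices \<open>S\<close> and
  \<open>\<kappa>\<close> of all the monomial parts are stored in one function each; only their values on pairs
  from the same part are used.
\<close>

record 'n kuramoto =
  num_M   :: nat                            \<comment> \<open>\<open>m\<close>\<close>
  num_C   :: nat                            \<comment> \<open>\<open>c\<close>\<close>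
  part_M  :: "nat \<Rightarrow> 'n set"                \<comment> \<open>\<open>\<M>\<^sub>\<tau>\<close>\<close>
  part_C  :: "nat \<Rightarrow> 'n set"                \<comment> \<open>\<open>\<C>\<^sub>\<gamma>\<close>\<close>
  part_P  :: "'n set"                       \<comment> \<open>\<open>\<P>\<close>\<close>
  freq    :: "real ^ 'n"                    \<comment> \<open>\<open>\<omega>\<close>\<close>
  weight  :: "'n \<Rightarrow> 'n \<Rightarrow> real"             \<comment> \<open>\<open>W\<close>\<close>
  lag     :: "'n \<Rightarrow> 'n \<Rightarrow> real"             \<comment> \<open>\<open>\<alpha>\<close>\<close>
  mu_coef :: "nat \<Rightarrow> 'n \<Rightarrow> real"            \<comment> \<open>\<open>\<mu>\<close>\<close>
  S_coef  :: "'n \<Rightarrow> 'n \<Rightarrow> real"             \<comment> \<open>\<open>S\<close>\<close>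
  kappa   :: "'n \<Rightarrow> 'n \<Rightarrow> real"             \<comment> \<open>\<open>\<kappa>\<close>\<close>
  C_coef  :: "'n \<Rightarrow> nat \<Rightarrow> real"            \<comment> \<open>\<open>C\<close>\<close>
  chi     :: "'n \<Rightarrow> nat \<Rightarrow> real"            \<comment> \<open>\<open>\<chi>\<close>\<close>
  ref     :: "nat \<Rightarrow> 'n"                    \<comment> \<open>\<open>\<ell>\<^sub>\<gamma>\<close>\<close>

definition calA :: "('n::finite, 'x) kuramoto_scheme \<Rightarrow> nat \<Rightarrow> 'n \<Rightarrow> complex" where
  "calA K \<gamma> k = 1/2 * of_real (C_coef K k \<gamma>) * cis (- chi K k \<gamma>)"

definition Omega :: "('n::finite, 'x) kuramoto_scheme \<Rightarrow> nat \<Rightarrow> real" where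
  "Omega K \<gamma> = freq K $ ref K \<gamma> - 2 * Im (calA K \<gamma> (ref K \<gamma>))"

definition Amat :: "('n::finite, 'x) kuramoto_scheme \<Rightarrow> 'n \<Rightarrow> 'n \<Rightarrow> complex" where
  "Amat K j k =
     (if j = k then \<i> / 2 * of_real (freq K $ j)
      else 1/2 * of_real (weight K j k) * cis (- lag K j k))"

definition all_M :: "('n::finite, 'x) kuramoto_scheme \<Rightarrow> 'n set" where
  "all_M K = (\<Union>\<tau>\<in>{1..num_M K}. part_M K \<tau>)"

definition is_partition :: "('n::finite, 'x) kuramoto_scheme \<Rightarrow> bool" where
  "is_partition K \<longleftrightarrow>
     all_M K \<union> (\<Union>\<gamma>\<in>{1..num_C K}. part_C K \<gamma>) \<union> part_P K = UNIV \<and>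
     disjoint_family_on (part_M K) {1..num_M K} \<and>
     disjoint_family_on (part_C K) {1..num_C K} \<and>
     all_M K \<inter> (\<Union>\<gamma>\<in>{1..num_C K}. part_C K \<gamma>) = {} \<and>
     all_M K \<inter> part_P K = {} \<and>
     (\<Union>\<gamma>\<in>{1..num_C K}. part_C K \<gamma>) \<inter> part_P K = {} \<and>
     (\<forall>\<tau>\<in>{1..num_M K}. card (part_M K \<tau>) \<ge> 1) \<and>
     (\<forall>\<gamma>\<in>{1..num_C K}. card (part_C K \<gamma>) \<ge> 4)"

definition partitioned_kuramoto :: "('n::finite, 'x) kuramoto_scheme \<Rightarrow> bool" where
  "partitioned_kuramoto K \<longleftrightarrow>
     is_partition K \<and>
     (\<forall>j k. - pi / 2 < lag K j k \<and> lag K j k \<le> pi / 2) \<and>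
     (\<forall>j. weight K j j = 0 \<and> lag K j j = 0) \<and>
     (\<forall>\<tau>\<in>{1..num_M K}. \<forall>j\<in>part_M K \<tau>.
        mu_coef K \<tau> j \<noteq> 0 \<and>
        S_coef K j j = 0 \<and>
        (\<forall>k\<in>part_M K \<tau>.
           S_coef K j k = S_coef K k j \<and>
           kappa K j k = - kappa K k j \<and>
           \<bar>kappa K j k\<bar> < pi / 2 \<and>
           weight K j k = S_coef K j k / mu_coef K \<tau> j \<and>
           lag K j k = kappa K j k) \<and>
        (\<forall>k. k \<notin> part_M K \<tau> \<longrightarrow> weight K j k = 0 \<and> lag K j k = 0)) \<and>
     (\<forall>\<gamma>\<in>{1..num_C K}.
        (\<forall>k. \<bar>chi K k \<gamma>\<bar> < pi / 2) \<and>
        ref K \<gamma> \<in> part_C K \<gamma> \<and>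
        (\<forall>j\<in>part_C K \<gamma>.
           (\<forall>k. k \<noteq> j \<longrightarrow> weight K j k = C_coef K k \<gamma> \<and> lag K j k = chi K k \<gamma>) \<and>
           freq K $ j = freq K $ ref K \<gamma> + 2 * Im (calA K \<gamma> j - calA K \<gamma> (ref K \<gamma>))))"

definition kuramoto_solution ::
    "('n::finite, 'x) kuramoto_scheme \<Rightarrow> real set \<Rightarrow> (real \<Rightarrow> real ^ 'n) \<Rightarrow> bool" where
  "kuramoto_solution K T \<theta> \<longleftrightarrow>
     open T \<and> is_interval T \<and>
     (\<forall>t\<in>T. \<forall>j. ((\<lambda>s. \<theta> s $ j) has_real_derivative
        freq K $ j + (\<Sum>k\<in>UNIV. weight K j k * sin (\<theta> t $ k - \<theta> t $ j - lag K j k))) (at t))"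

section \<open>Change of coordinates on the monomial parts\<close>

definition mu_vec :: "('n::finite, 'x) kuramoto_scheme \<Rightarrow> nat \<Rightarrow> real ^ 'n" where
  "mu_vec K \<tau> = (\<chi> j. if j \<in> part_M K \<tau> then mu_coef K \<tau> j else 0)"

definition omega_tilde :: "('n::finite, 'x) kuramoto_scheme \<Rightarrow> nat \<Rightarrow> real" where
  "omega_tilde K \<tau> = mu_vec K \<tau> \<bullet> freq K"

definition nu :: "('n::finite, 'x) kuramoto_scheme \<Rightarrow> nat \<Rightarrow> real ^ 'n" where
  "nu K \<eta> = omega_tilde K (\<eta> + 1) *\<^sub>R mu_vec K \<eta> - omega_tilde K \<eta> *\<^sub>R mu_vec K (\<eta> + 1)"

definition j_max :: "('n::{finite,linorder}, 'x) kuramoto_scheme \<Rightarrow> nat \<Rightarrow> 'n" where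
  "j_max K \<eta> = Max (part_M K \<eta>)"

definition elim_M :: "('n::{finite,linorder}, 'x) kuramoto_scheme \<Rightarrow> 'n set" where
  "elim_M K = j_max K ` {1..<num_M K}"

definition kept_M :: "('n::{finite,linorder}, 'x) kuramoto_scheme \<Rightarrow> 'n set" where
  "kept_M K = all_M K - elim_M K"

definition phi :: "('n::{finite,linorder}, 'x) kuramoto_scheme \<Rightarrow> (real, 'n) vec \<Rightarrow> 'n \<Rightarrow> real" where
  "phi K x j =
     (if j \<in> elim_M K then nu K (THE \<eta>. \<eta> \<in> {1..<num_M K} \<and> j_max K \<eta> = j) \<bullet> x
      else x $ j)"

definition Vmat :: "('n::{finite,linorder}, 'x) kuramoto_scheme \<Rightarrow> 'n \<Rightarrow> 'n \<Rightarrow> real" where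
  "Vmat K j k = phi K (axis k 1) j"

text \<open>
  Two-sided inverse of a matrix indexed by a subset \<open>A\<close> of the vertices.  \<open>Vmat K\<close> has an inverse
  on \<open>all_M K\<close> only if \<open>omega_tilde K \<tau> \<noteq> 0\<close> for \<open>2 \<le> \<tau> \<le> num_M K\<close>, so statements about the inverse
  take it as a given matrix with this property.
\<close>

definition inverse_matrix_on :: "'n set \<Rightarrow> ('n \<Rightarrow> 'n \<Rightarrow> real) \<Rightarrow> ('n \<Rightarrow> 'n \<Rightarrow> real) \<Rightarrow> bool" where
  "inverse_matrix_on A B B' \<longleftrightarrow>
     (\<forall>j\<in>A. \<forall>k\<in>A.
        (\<Sum>l\<in>A. B j l * B' l k) = (if j = k then 1 else 0) \<and>
        (\<Sum>l\<in>A. B' j l * B l k) = (if j = k then 1 else 0))"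

section \<open>The reduced system\<close>

text \<open>
  Below, \<open>Vi\<close> is the inverse of the coordinate matrix on \<open>all_M K\<close>, \<open>\<kappa>0 \<eta>\<close> is the constant
  \<open>\<kappa>\<^sub>\<eta>\<close>, and a reduced state consists of \<open>\<phi> l\<close> for \<open>l \<in> kept_M K\<close> (with \<open>\<xi>\<^sub>l = cis (\<phi> l)\<close>),
  of \<open>Z \<gamma>\<close> and \<open>\<zeta> \<gamma>\<close> for \<open>1 \<le> \<gamma> \<le> num_C K\<close>, and of \<open>z k\<close> for \<open>k \<in> part_P K\<close>.  No other
  values of these functions enter the right-hand sides.
\<close>

definition disk_moebius :: "complex \<Rightarrow> complex \<Rightarrow> complex \<Rightarrow> complex" where
  "disk_moebius Z \<zeta> w = (\<zeta> * w + Z) / (1 + \<zeta> * cnj Z * w)"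

definition kappa0 ::
    "('n::{finite,linorder}, 'x) kuramoto_scheme \<Rightarrow> ('n \<Rightarrow> 'n \<Rightarrow> real) \<Rightarrow> (real, 'n) vec \<Rightarrow> nat \<Rightarrow> real" where
  "kappa0 K Vi x0 \<eta> = (\<Sum>\<epsilon>\<in>{1..<num_M K}. Vi (j_max K \<eta>) (j_max K \<epsilon>) * (nu K \<epsilon> \<bullet> x0))"

definition xi_mono ::
    "('n::{finite,linorder}, 'x) kuramoto_scheme \<Rightarrow> ('n \<Rightarrow> 'n \<Rightarrow> real) \<Rightarrow> ('n \<Rightarrow> real) \<Rightarrow> nat \<Rightarrow> complex"
  where
  "xi_mono K Vi \<phi> \<eta> = exp (\<i> * of_real (\<Sum>l\<in>kept_M K. Vi (j_max K \<eta>) l * \<phi> l))"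

definition mono_rhs ::
    "('n::{finite,linorder}, 'x) kuramoto_scheme \<Rightarrow> ('n \<Rightarrow> 'n \<Rightarrow> real) \<Rightarrow> (nat \<Rightarrow> real) \<Rightarrow>
     ('n \<Rightarrow> real) \<Rightarrow> nat \<Rightarrow> 'n \<Rightarrow> complex" where
  "mono_rhs K Vi \<kappa>0 \<phi> \<eta> j =
     (let \<xi> = (\<lambda>k. cis (\<phi> k)); x = xi_mono K Vi \<phi> \<eta>; j\<eta> = j_max K \<eta> in
      \<i> * of_real (freq K $ j) * \<xi> j
      + 1 / (2 * of_real (mu_coef K \<eta> j)) *
          (\<Sum>k\<in>part_M K \<eta> - {j\<eta>}. of_real (S_coef K j k) *
             (\<xi> k * cis (- kappa K j k) - cnj (\<xi> k) * (\<xi> j)^2 * cis (kappa K j k)))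
      + 1 / (2 * of_real (mu_coef K \<eta> j)) * of_real (S_coef K j j\<eta>) *
          (x * cis (\<kappa>0 \<eta> - kappa K j j\<eta>)
           - cnj x * (\<xi> j)^2 * cis (- (\<kappa>0 \<eta> - kappa K j j\<eta>))))"

definition mono_rhs_last ::
    "('n::finite, 'x) kuramoto_scheme \<Rightarrow> ('n \<Rightarrow> real) \<Rightarrow> 'n \<Rightarrow> complex" where
  "mono_rhs_last K \<phi> j =
     (let \<xi> = (\<lambda>k. cis (\<phi> k)) in
      \<i> * of_real (freq K $ j) * \<xi> j
      + 1 / (2 * of_real (mu_coef K (num_M K) j)) *
          (\<Sum>k\<in>part_M K (num_M K). of_real (S_coef K j k) *
             (\<xi> k * cis (- kappa K j k) - cnj (\<xi> k) * (\<xi> j)^2 * cis (kappa K j k))))"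

text \<open>\<open>F\<^sub>\<gamma>\<close> and \<open>G\<^sub>j\<close> are the same expression, with coefficients \<open>a = calA K \<gamma>\<close> and
  \<open>a = Amat K j\<close>.\<close>

definition coupling ::
    "('n::{finite,linorder}, 'x) kuramoto_scheme \<Rightarrow> ('n \<Rightarrow> 'n \<Rightarrow> real) \<Rightarrow> (nat \<Rightarrow> real) \<Rightarrow>
     ('n \<Rightarrow> complex) \<Rightarrow> ('n \<Rightarrow> complex) \<Rightarrow>
     ('n \<Rightarrow> real) \<Rightarrow> (nat \<Rightarrow> complex) \<Rightarrow> (nat \<Rightarrow> complex) \<Rightarrow> ('n \<Rightarrow> complex) \<Rightarrow> complex" where
  "coupling K Vi \<kappa>0 w a \<phi> Z \<zeta> z =
     (\<Sum>k\<in>kept_M K. a k * cis (\<phi> k))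
     + (\<Sum>\<epsilon>\<in>{1..<num_M K}. a (j_max K \<epsilon>) * cis (\<kappa>0 \<epsilon>) * xi_mono K Vi \<phi> \<epsilon>)
     + (\<Sum>\<delta>\<in>{1..num_C K}. \<Sum>k\<in>part_C K \<delta>. a k * disk_moebius (Z \<delta>) (\<zeta> \<delta>) (w k))
     + (\<Sum>k\<in>part_P K. a k * z k)"

definition reduced_solution ::
    "('n::{finite,linorder}, 'x) kuramoto_scheme \<Rightarrow> ('n \<Rightarrow> 'n \<Rightarrow> real) \<Rightarrow> (nat \<Rightarrow> real) \<Rightarrow>
     ('n \<Rightarrow> complex) \<Rightarrow> real set \<Rightarrow>
     (real \<Rightarrow> 'n \<Rightarrow> real) \<Rightarrow> (real \<Rightarrow> nat \<Rightarrow> complex) \<Rightarrow> (real \<Rightarrow> nat \<Rightarrow> complex) \<Rightarrow>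
     (real \<Rightarrow> 'n \<Rightarrow> complex) \<Rightarrow> bool" where
  "reduced_solution K Vi \<kappa>0 w T \<phi> Z \<zeta> z \<longleftrightarrow> (\<forall>t\<in>T.
     (\<forall>\<eta>\<in>{1..<num_M K}. \<forall>j\<in>part_M K \<eta> - {j_max K \<eta>}.
        ((\<lambda>s. cis (\<phi> s j)) has_vector_derivative mono_rhs K Vi \<kappa>0 (\<phi> t) \<eta> j) (at t)) \<and>
     (1 \<le> num_M K \<longrightarrow> (\<forall>j\<in>part_M K (num_M K).
        ((\<lambda>s. cis (\<phi> s j)) has_vector_derivative mono_rhs_last K (\<phi> t) j) (at t))) \<and>
     (\<forall>\<gamma>\<in>{1..num_C K}.
        let F = coupling K Vi \<kappa>0 w (calA K \<gamma>) (\<phi> t) (Z t) (\<zeta> t) (z t);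
            i\<Omega> = \<i> * of_real (Omega K \<gamma>)
        in ((\<lambda>s. Z s \<gamma>) has_vector_derivative
              F + i\<Omega> * Z t \<gamma> - cnj F * (Z t \<gamma>)^2) (at t) \<and>
           ((\<lambda>s. \<zeta> s \<gamma>) has_vector_derivative
              (i\<Omega> + F * cnj (Z t \<gamma>) - cnj F * Z t \<gamma>) * \<zeta> t \<gamma>) (at t)) \<and>
     (\<forall>j\<in>part_P K.
        let G = coupling K Vi \<kappa>0 w (Amat K j) (\<phi> t) (Z t) (\<zeta> t) (z t)
        in ((\<lambda>s. z s j) has_vector_derivative G - cnj G * (z t j)^2) (at t)))"

text \<open>
  Number of real coordinates of a reduced state: one for each of the unimodular \<open>\<xi>\<^sub>j\<close>, \<open>\<zeta>\<^sub>\<gamma>\<close>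
  and \<open>z\<^sub>j\<close>, and two for each \<open>Z\<^sub>\<gamma>\<close> in the open unit disk.
\<close>

definition reduced_dim :: "('n::{finite,linorder}, 'x) kuramoto_scheme \<Rightarrow> nat" where
  "reduced_dim K = card (kept_M K) + num_C K * (DIM(complex) + 1) + card (part_P K)"

section \<open>Constants of motion\<close>

definition constant_of_motion ::
    "('n::finite, 'x) kuramoto_scheme \<Rightarrow> (real ^ 'n \<Rightarrow> real) \<Rightarrow> bool" where
  "constant_of_motion K f \<longleftrightarrow>
     (\<forall>T \<theta>. kuramoto_solution K T \<theta> \<longrightarrow> (\<forall>s\<in>T. \<forall>t\<in>T. f (\<theta> s) = f (\<theta> t)))"

text \<open>
  Functional independence: on a dense open set the functions are continuously differentiable
  with linearly independent gradients.  (Cross-ratios are singular where phases collide, so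
  one cannot ask for this at every point.)
\<close>

definition functionally_independent :: "nat \<Rightarrow> (nat \<Rightarrow> 'a::euclidean_space \<Rightarrow> real) \<Rightarrow> bool" where
  "functionally_independent q f \<longleftrightarrow>
     (\<exists>U g. open U \<and> closure U = UNIV \<and>
        (\<forall>i<q. continuous_on U (g i) \<and> (\<forall>x\<in>U. GDERIV (f i) x :> g i x)) \<and>
        (\<forall>x\<in>U. \<forall>a :: nat \<Rightarrow> real. (\<Sum>i<q. a i *\<^sub>R g i x) = 0 \<longrightarrow> (\<forall>i<q. a i = 0)))"

end

theory Submission
  imports Defs
begin

text \<open>On a monomial part the interaction is antisymmetric after multiplication by \<open>\<mu>\<close>, so
  \<open>\<mu>\<^sub>\<tau> \<bullet> \<theta>\<close> grows linearly with slope \<open>omega_tilde K \<tau>\<close> and suitable differences of these are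
  constant.  On a cross-ratio part all phases obey the same Riccati equation driven by the mean
  field \<open>F\<close>.  Its flow consists of Moebius transformations of the disk, obtained from a linear
  equation on \<open>SU(1,1)\<close>-type matrices with continuous coefficients; uniqueness for the Riccati
  equation identifies the phases with the moving images of the base points \<open>w\<close>.  Cross-ratios of
  the phases are therefore conserved.\<close>

section \<open>Ordinary differential equations\<close>

text \<open>Two obstacles shape the argument. The Riccati equation is quadratic, hence not globally
  Lipschitz, and a direct existence theorem would give its solution only locally. The linear
  equation behind it has a Lipschitz constant on every compact time interval, so Picard iteration
  yields a solution on all of \<open>T\<close>; uniqueness for the Riccati equation comes from a
  linear equation for the difference of two solutions. The second obstacle is degeneracy. Only one
  \<open>omega_tilde\<close> is assumed nonzero, and if two consecutive ones vanish, the
  corresponding \<open>nu\<close> is the zero vector. The vectors \<open>nu\<close> therefore cannot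
  supply the independent constants of motion in general; each part is compared instead with one
  fixed part whose \<open>omega_tilde\<close> is nonzero. Cross-ratios are written with sines of
  half phase differences: they are then real, smooth away from collisions, and each sine obeys a
  scalar linear equation along solutions.\<close>

text \<open>Bounds on continuous functions and Lipschitz constants are available on compact
  intervals only. Strict inequalities at both ends turn derivatives within the compact interval into
  ordinary ones.\<close>

lemma open_interval_compact_subinterval:
  fixes T :: "real set"
  assumes "open T" "is_interval T" "s \<in> T" "t \<in> T"
  obtains a b where "a < s" "s < b" "a < t" "t < b" "{a..b} \<subseteq> T"
proof -
  have "min s t \<in> T" "max s t \<in> T"
    using assms by (auto simp: min_def max_def)
  then obtain d e where d: "d > 0" "cball (min s t) d \<subseteq> T" and e: "e > 0" "cball (max s t) e \<subseteq> T"
    using \<open>open T\<close> open_contains_cball by metis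
  have "min s t - d \<in> T" "max s t + e \<in> T"
    using d e by (auto simp: subset_iff dist_real_def)
  then have "{min s t - d..max s t + e} \<subseteq> T"
    using \<open>is_interval T\<close> unfolding is_interval_1 by (meson atLeastAtMost_iff subsetI)
  with d e show ?thesis
    by (intro that[of "min s t - d" "max s t + e"]) auto
qed

lemma antiderivative_on_open_interval:
  fixes f :: "real \<Rightarrow> 'a::banach"
  assumes T: "open T" "is_interval T" "t0 \<in> T" and cont: "continuous_on T f"
  shows "\<exists>g. g t0 = y0 \<and> (\<forall>t\<in>T. (g has_vector_derivative f t) (at t))"
proof -
  \<comment> \<open>An integral over \<open>{t0..t}\<close> is zero for \<open>t < t0\<close>, so
    times before \<open>t0\<close> need the reversed integral with a minus sign.\<close>
  define g where "g = (\<lambda>t. y0 + (if t0 \<le> t then integral {t0..t} f else - integral {t..t0} f))"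
  have "(g has_vector_derivative f t) (at t)" if "t \<in> T" for t
  proof -
    obtain a b where ab: "a < t0" "t0 < b" "a < t" "t < b" "{a..b} \<subseteq> T"
      using open_interval_compact_subinterval[OF T(1,2,3) \<open>t \<in> T\<close>] .
    have c: "continuous_on {a..b} f"
      using cont ab(5) continuous_on_subset by blast
    have int: "f integrable_on {u..v}" if "a \<le> u" "v \<le> b" for u v
      using c that by (intro integrable_continuous_real continuous_on_subset[OF c]) auto
    \<comment> \<open>Moving the base point to \<open>a\<close>, left of both \<open>t0\<close> and
      \<open>t\<close>, gives a single formula on both sides of \<open>t0\<close>, so
      differentiability at \<open>t0\<close> itself needs no separate argument.\<close>
    have eq: "y0 - integral {a..t0} f + integral {a..s} f = g s" if "s \<in> {a<..<b}" for s
    proof (cases "t0 \<le> s")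
      case True
      then show ?thesis
        using Henstock_Kurzweil_Integration.integral_combine[of a t0 s f] int ab that by (simp add: g_def algebra_simps)
    next
      case False
      then show ?thesis
        using Henstock_Kurzweil_Integration.integral_combine[of a s t0 f] int ab that by (simp add: g_def algebra_simps)
    qed
    have "((\<lambda>u. integral {a..u} f) has_vector_derivative f t) (at t within {a..b})"
      using integral_has_vector_derivative[OF c] ab by auto
    then have "((\<lambda>u. integral {a..u} f) has_vector_derivative f t) (at t)"
      using ab by (simp add: at_within_Icc_at)
    then have "((\<lambda>u. y0 - integral {a..t0} f + integral {a..u} f) has_vector_derivative f t) (at t)"
      by (auto intro!: derivative_eq_intros)
    then show ?thesis
      by (rule has_vector_derivative_transform_within_open[of _ _ _ "{a<..<b}"]) (use ab eq in auto)
  qed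
  then show ?thesis
    by (intro exI[of _ g]) (auto simp: g_def)
qed

lemma zero_vector_derivative_constant:
  fixes f :: "real \<Rightarrow> 'a::real_normed_vector"
  assumes "is_interval T" "\<And>t. t \<in> T \<Longrightarrow> (f has_vector_derivative 0) (at t)" "s \<in> T" "t \<in> T"
  shows "f s = f t"
proof -
  have "\<exists>c. \<forall>x\<in>T. f x = c"
    using assms(2) by (intro has_derivative_zero_constant)
      (auto simp: has_vector_derivative_def is_interval_convex[OF assms(1)]
            intro: has_derivative_at_withinI)
  with assms(3,4) show ?thesis by auto
qed

text \<open>The product of \<open>e\<close> with \<open>exp (- A)\<close> has derivative zero. The
  field is left general: the complex case serves uniqueness for the Riccati equation, the real case
  the half-angle sines.\<close>

lemma linear_ode_integrating_factor:
  fixes e a :: "real \<Rightarrow> 'a::{banach,real_normed_field}"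
  assumes T: "is_interval T" "s \<in> T" "t \<in> T"
    and e: "\<And>t. t \<in> T \<Longrightarrow> (e has_vector_derivative a t * e t) (at t)"
    and A: "\<And>t. t \<in> T \<Longrightarrow> (A has_vector_derivative a t) (at t)"
  shows "e s * exp (- A s) = e t * exp (- A t)"
proof (rule zero_vector_derivative_constant[OF T(1) _ T(2,3)])
  fix t assume t: "t \<in> T"
  have d: "((exp \<circ> (\<lambda>t. - A t)) has_vector_derivative (- a t) * exp (- A t)) (at t)"
    using A[OF t] by (intro field_vector_diff_chain_at DERIV_exp) (auto intro!: derivative_intros)
  then show "((\<lambda>t. e t * exp (- A t)) has_vector_derivative 0) (at t)"
    using has_vector_derivative_mult[OF e[OF t] d]
    by (simp add: o_def algebra_simps)
qed

text \<open>The integrating factor never vanishes, so a zero of \<open>e\<close> at one time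
  propagates to all times; this replaces a Gronwall estimate.\<close>

lemma linear_ode_zero:
  fixes e a :: "real \<Rightarrow> 'a::{banach,real_normed_field}"
  assumes T: "open T" "is_interval T" "s \<in> T" "t \<in> T"
    and e: "\<And>t. t \<in> T \<Longrightarrow> (e has_vector_derivative a t * e t) (at t)"
    and a: "continuous_on T a" and "e s = 0"
  shows "e t = 0"
proof -
  obtain A where "\<And>t. t \<in> T \<Longrightarrow> (A has_vector_derivative a t) (at t)"
    using antiderivative_on_open_interval[OF T(1-3) a] by blast
  from linear_ode_integrating_factor[OF T(2-4) e this] \<open>e s = 0\<close> show ?thesis by simp
qed

text \<open>This is the inductive step of the Picard estimate: integrating a bound of order
  \<open>n\<close> gains one power of the elapsed time and the divisor \<open>Suc n\<close>, from
  which the factorials arise. The case \<open>n = 0\<close> is the mean value inequality.\<close>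

lemma vector_derivative_power_bound:
  fixes f :: "real \<Rightarrow> 'a::real_normed_vector"
  assumes S: "is_interval S" "t0 \<in> S" "t \<in> S"
    and deriv: "\<And>t. t \<in> S \<Longrightarrow> (f has_vector_derivative f' t) (at t)"
    and bound: "\<And>t. t \<in> S \<Longrightarrow> norm (f' t) \<le> C * \<bar>t - t0\<bar> ^ n"
  shows "norm (f t - f t0) \<le> C * \<bar>t - t0\<bar> ^ Suc n / Suc n"
proof -
  \<comment> \<open>The segment from \<open>t0\<close> to \<open>t\<close> is parametrised by the
    unit interval, which treats \<open>t < t0\<close> and \<open>t > t0\<close> alike.\<close>
  define r where "r = t - t0"
  have mem: "t0 + u * r \<in> S" if "0 \<le> u" "u \<le> 1" for u
  proof -
    have "t0 + u * r = (1 - u) *\<^sub>R t0 + u *\<^sub>R t" by (simp add: r_def algebra_simps)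
    also have "\<dots> \<in> S"
      using is_interval_convex[OF S(1)] S(2,3) that by (auto simp: convex_alt)
    finally show ?thesis .
  qed
  have der: "((\<lambda>u. f (t0 + u * r)) has_vector_derivative r *\<^sub>R f' (t0 + u * r)) (at u)"
    if "0 \<le> u" "u \<le> 1" for u
  proof -
    have "((\<lambda>u. t0 + u * r) has_vector_derivative r) (at u)"
      by (auto intro!: derivative_eq_intros)
    from vector_diff_chain_at[OF this deriv[OF mem[OF that]]] show ?thesis
      by (simp add: o_def)
  qed
  have "norm (f (t0 + 1 * r) - f (t0 + 0 * r))
      \<le> C * \<bar>r\<bar> ^ Suc n * 1 ^ Suc n / Suc n - C * \<bar>r\<bar> ^ Suc n * 0 ^ Suc n / Suc n"
  proof (rule differentiable_bound_general[where f = "\<lambda>u. f (t0 + u * r)"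
        and \<phi> = "\<lambda>u. C * \<bar>r\<bar> ^ Suc n * u ^ Suc n / Suc n" and \<phi>' = "\<lambda>u. C * \<bar>r\<bar> ^ Suc n * u ^ n"])
    show "continuous_on {0..1} (\<lambda>u. f (t0 + u * r))"
      by (intro continuous_at_imp_continuous_on) (auto intro!: has_vector_derivative_continuous der)
    show "((\<lambda>u. C * \<bar>r\<bar> ^ Suc n * u ^ Suc n / real (Suc n)) has_vector_derivative C * \<bar>r\<bar> ^ Suc n * x ^ n) (at x)" for x
      unfolding has_real_derivative_iff_has_vector_derivative[symmetric]
      by (auto intro!: derivative_eq_intros simp del: power_Suc of_nat_Suc)
    show "norm (r *\<^sub>R f' (t0 + x * r)) \<le> C * \<bar>r\<bar> ^ Suc n * x ^ n" if "0 < x" "x < 1" for x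
    proof -
      have "norm (r *\<^sub>R f' (t0 + x * r)) \<le> \<bar>r\<bar> * (C * \<bar>x * r\<bar> ^ n)"
        using bound[OF mem[of x]] that by (auto intro!: mult_left_mono)
      then show ?thesis
        using that by (simp add: abs_mult power_mult_distrib algebra_simps)
    qed
  qed (auto intro!: continuous_intros der)
  then show ?thesis by (simp add: r_def)
qed

text \<open>The Lipschitz constant may depend on the compact time interval but not on the state;
  hence the iterates converge on every compact subinterval and the solution lives on all of
  \<open>T\<close>. Continuity is required only along continuous curves, which is what integrating
  the right-hand side needs.\<close>

theorem picard_lindeloef_global:
  fixes f :: "real \<Rightarrow> 'a::banach \<Rightarrow> 'a"
  assumes T: "open T" "is_interval T" "t0 \<in> T"
    and cont: "\<And>y. continuous_on T y \<Longrightarrow> continuous_on T (\<lambda>t. f t (y t))"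
    and lipschitz: "\<And>a b. {a..b} \<subseteq> T \<Longrightarrow>
      \<exists>L. \<forall>t\<in>{a..b}. \<forall>x y. norm (f t x - f t y) \<le> L * norm (x - y)"
  shows "\<exists>y. y t0 = y0 \<and> (\<forall>t\<in>T. (y has_vector_derivative f t (y t)) (at t))"
proof -
  have cont_deriv: "continuous_on S g"
    if "\<And>t. t \<in> S \<Longrightarrow> (g has_vector_derivative g' t) (at t)" for g g' and S :: "real set"
    using that by (intro continuous_at_imp_continuous_on) (auto intro: has_vector_derivative_continuous)
  \<comment> \<open>The Picard operator: \<open>step y\<close> is an antiderivative of the
    right-hand side along \<open>y\<close>, with value \<open>y0\<close> at
    \<open>t0\<close>.\<close>
  define step where "step y = (SOME g. g t0 = y0 \<and> (\<forall>t\<in>T. (g has_vector_derivative f t (y t)) (at t)))" for y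
  have step: "step y t0 = y0 \<and> (\<forall>t\<in>T. (step y has_vector_derivative f t (y t)) (at t))"
    if "continuous_on T y" for y
    unfolding step_def
    by (rule someI_ex[of "\<lambda>g. g t0 = y0 \<and> (\<forall>t\<in>T. (g has_vector_derivative f t (y t)) (at t))"])
      (rule antiderivative_on_open_interval[OF T cont[OF that]])
  define Y where "Y n = (step ^^ n) (\<lambda>_. y0)" for n
  have Y_Suc: "Y (Suc n) = step (Y n)" for n by (simp add: Y_def)
  have Y_cont: "continuous_on T (Y n)" for n
  proof (induction n)
    case 0
    then show ?case by (simp add: Y_def)
  next
    case (Suc n)
    then show ?case unfolding Y_Suc using step[OF Suc] by (auto intro: cont_deriv)
  qed
  have Y_deriv: "(Y (Suc n) has_vector_derivative f t (Y n t)) (at t)" if "t \<in> T" for n t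
    using step[OF Y_cont] that by (simp add: Y_Suc)
  have Y_t0: "Y n t0 = y0" for n
    using step[OF Y_cont] by (cases n) (simp_all add: Y_Suc Y_def[of 0])
  \<comment> \<open>The iterates are partial sums of their increments, so uniform convergence can be
    obtained from the Weierstrass M-test.\<close>
  define D where "D n t = Y (Suc n) t - Y n t" for n t
  define y where "y t = y0 + (\<Sum>n. D n t)" for t
  have lim: "uniform_limit {a..b} Y y sequentially" if ab: "{a..b} \<subseteq> T" "t0 \<in> {a..b}" for a b
  proof -
    obtain L where L: "\<And>t x y. t \<in> {a..b} \<Longrightarrow> norm (f t x - f t y) \<le> L * norm (x - y)"
      using lipschitz[OF ab(1)] by blast
    \<comment> \<open>The given constant may be negative in degenerate cases; the estimates multiply
      inequalities by it and raise it to powers, which needs a nonnegative one.\<close>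
    define L' where "L' = max L 0"
    have L': "norm (f t x - f t y) \<le> L' * norm (x - y)" if "t \<in> {a..b}" for t x y
      using L[OF that, of x y] mult_right_mono[of L L' "norm (x - y)"] by (auto simp: L'_def)
    have "continuous_on {a..b} (D 0)"
      unfolding D_def by (intro continuous_on_subset[OF _ ab(1)] continuous_intros Y_cont)
    then have "bounded (D 0 ` {a..b})"
      by (intro compact_imp_bounded compact_continuous_image) auto
    then obtain M where M: "\<And>t. t \<in> {a..b} \<Longrightarrow> norm (D 0 t) \<le> M"
      unfolding bounded_iff by blast
    have D_bound: "norm (D n t) \<le> M * L' ^ n / fact n * \<bar>t - t0\<bar> ^ n" if "t \<in> {a..b}" for n t
      using that
    proof (induction n arbitrary: t)
      case 0
      then show ?case using M by simp
    next
      case (Suc n)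
      have "norm (D (Suc n) t - D (Suc n) t0) \<le> (M * L' ^ Suc n / fact n) * \<bar>t - t0\<bar> ^ Suc n / Suc n"
      proof (rule vector_derivative_power_bound[of "{a..b}"])
        show "(D (Suc n) has_vector_derivative f t (Y (Suc n) t) - f t (Y n t)) (at t)"
          if "t \<in> {a..b}" for t
          unfolding D_def using Y_deriv that ab(1) by (intro derivative_intros) auto
        show "norm (f t (Y (Suc n) t) - f t (Y n t)) \<le> M * L' ^ Suc n / fact n * \<bar>t - t0\<bar> ^ n"
          if "t \<in> {a..b}" for t
        proof -
          have "L' * norm (D n t) \<le> L' * (M * L' ^ n / fact n * \<bar>t - t0\<bar> ^ n)"
            using Suc.IH[OF that] by (intro mult_left_mono) (auto simp: L'_def)
          then show ?thesis
            using L'[OF that, of "Y (Suc n) t" "Y n t"] by (simp add: D_def algebra_simps)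
        qed
      qed (use Suc.prems ab in auto)
      moreover have "D (Suc n) t0 = 0" by (simp add: D_def Y_t0)
      ultimately show ?case by (simp add: algebra_simps)
    qed
    have M0: "M \<ge> 0" using M[OF ab(2)] norm_ge_zero order_trans by blast
    have "norm (D n t) \<le> M * ((L' * (b - a)) ^ n / fact n)" if "t \<in> {a..b}" for n t
    proof -
      have "M * L' ^ n / fact n * \<bar>t - t0\<bar> ^ n \<le> M * L' ^ n / fact n * (b - a) ^ n"
        using that ab(2) M0 by (intro mult_left_mono power_mono divide_nonneg_nonneg mult_nonneg_nonneg)
          (auto simp: L'_def)
      with D_bound[OF that, of n] show ?thesis by (simp add: power_mult_distrib mult_ac)
    qed
    moreover have "summable (\<lambda>n. M * ((L' * (b - a)) ^ n / fact n))"
      using summable_exp[of "L' * (b - a)"] by (intro summable_mult) (simp add: field_simps)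
    ultimately have "uniform_limit {a..b} (\<lambda>n t. \<Sum>i<n. D i t) (\<lambda>t. \<Sum>i. D i t) sequentially"
      by (intro Weierstrass_m_test)
    then have "uniform_limit {a..b} (\<lambda>n t. y0 + (\<Sum>i<n. D i t)) y sequentially"
      unfolding y_def by (intro uniform_limit_intros)
    moreover have "y0 + (\<Sum>i<n. D i t) = Y n t" for n t
      using sum_lessThan_telescope[of "\<lambda>n. Y n t" n] by (simp add: D_def Y_def[of 0])
    ultimately show ?thesis by simp
  qed
  have "isCont y t" if "t \<in> T" for t
  proof -
    obtain a b where ab: "a < t0" "t0 < b" "a < t" "t < b" "{a..b} \<subseteq> T"
      using open_interval_compact_subinterval[OF T \<open>t \<in> T\<close>] .
    have "continuous_on {a..b} y"
      using ab by (intro uniform_limit_theorem[OF _ lim] always_eventually allI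
          continuous_on_subset[OF Y_cont]) auto
    then show ?thesis
      using ab by (simp add: continuous_on_interior)
  qed
  then have y_cont: "continuous_on T y"
    by (intro continuous_at_imp_continuous_on) auto
  \<comment> \<open>The limit \<open>y\<close> is so far only known to be continuous. Its image
    \<open>g\<close> under the Picard operator is differentiable, and it remains to show that
    \<open>y\<close> is a fixed point, since both are limits of \<open>Y (Suc n)\<close>.\<close>
  define g where "g = step y"
  have g: "g t0 = y0" "\<And>t. t \<in> T \<Longrightarrow> (g has_vector_derivative f t (y t)) (at t)"
    using step[OF y_cont] by (auto simp: g_def)
  have "g t = y t" if "t \<in> T" for t
  proof -
    obtain a b where ab: "a < t0" "t0 < b" "a < t" "t < b" "{a..b} \<subseteq> T"
      using open_interval_compact_subinterval[OF T \<open>t \<in> T\<close>] .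
    have ab': "t0 \<in> {a..b}" "t \<in> {a..b}" using ab by auto
    obtain L where L: "\<And>t x y. t \<in> {a..b} \<Longrightarrow> norm (f t x - f t y) \<le> L * norm (x - y)"
      using lipschitz[OF ab(5)] by blast
    have "(\<lambda>n. Y (Suc n) t) \<longlonglongrightarrow> g t"
    proof (rule metric_LIMSEQ_I)
      fix e :: real assume "e > 0"
      \<comment> \<open>Lipschitz constant times interval length: iterates within
        \<open>e / (2 * L')\<close> of \<open>y\<close> have images within \<open>e / 2\<close> of
        \<open>g\<close>. The maximum with 1 keeps the divisor positive.\<close>
      define L' where "L' = max L 1 * (b - a)"
      have "L' > 0" using ab by (simp add: L'_def)
      then have "eventually (\<lambda>n. \<forall>s\<in>{a..b}. dist (Y n s) (y s) < e / (2 * L')) sequentially"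
        using lim[OF ab(5) ab'(1)] \<open>e > 0\<close> by (auto simp: uniform_limit_iff)
      then obtain n0 where n0: "\<And>n s. n \<ge> n0 \<Longrightarrow> s \<in> {a..b} \<Longrightarrow> norm (Y n s - y s) < e / (2 * L')"
        unfolding eventually_sequentially dist_norm by blast
      have "dist (Y (Suc n) t) (g t) < e" if "n \<ge> n0" for n
      proof -
        have "norm ((Y (Suc n) t - g t) - (Y (Suc n) t0 - g t0))
            \<le> (max L 1 * (e / (2 * L'))) * \<bar>t - t0\<bar> ^ Suc 0 / Suc 0"
        proof (rule vector_derivative_power_bound[of "{a..b}"])
          show "((\<lambda>s. Y (Suc n) s - g s) has_vector_derivative f s (Y n s) - f s (y s)) (at s)"
            if "s \<in> {a..b}" for s
            using Y_deriv g(2) that ab(5) by (intro derivative_intros) auto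
          show "norm (f s (Y n s) - f s (y s)) \<le> max L 1 * (e / (2 * L')) * \<bar>s - t0\<bar> ^ 0"
            if "s \<in> {a..b}" for s
          proof -
            have "norm (f s (Y n s) - f s (y s)) \<le> L * norm (Y n s - y s)"
              using L[OF that] .
            also have "\<dots> \<le> max L 1 * (e / (2 * L'))"
              using n0[OF \<open>n \<ge> n0\<close> that] by (intro mult_mono) auto
            finally show ?thesis by simp
          qed
        qed (use ab' in auto)
        also have "\<dots> \<le> (max L 1 * (e / (2 * L'))) * (b - a)"
        proof -
          have "\<bar>t - t0\<bar> \<le> b - a" "0 \<le> max L 1 * (e / (2 * L'))"
            using ab \<open>e > 0\<close> \<open>L' > 0\<close> by auto
          from mult_left_mono[OF this] show ?thesis by simp
        qed
        also have "\<dots> = L' * (e / (2 * L'))"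
          by (simp add: L'_def)
        also have "\<dots> = e / 2" using \<open>L' > 0\<close> by simp
        also have "\<dots> < e" using \<open>e > 0\<close> by simp
        finally show ?thesis by (simp add: dist_norm Y_t0 g(1))
      qed
      then show "\<exists>no. \<forall>n\<ge>no. dist (Y (Suc n) t) (g t) < e" by blast
    qed
    moreover have "(\<lambda>n. Y (Suc n) t) \<longlonglongrightarrow> y t"
      using tendsto_uniform_limitI[OF lim[OF ab(5) ab'(1)] ab'(2)] LIMSEQ_Suc by blast
    ultimately show ?thesis using LIMSEQ_unique by blast
  qed
  then show ?thesis using g by (intro exI[of _ g]) auto
qed

section \<open>The Moebius group flow\<close>

lemma norm_less_1_imp_moebius_denominator_nonzero:
  assumes "norm Z < 1" "norm v \<le> 1"
  shows "1 + v * cnj Z \<noteq> 0"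
proof
  assume "1 + v * cnj Z = 0"
  then have "v * cnj Z = - 1" by (simp add: add_eq_0_iff)
  then have "norm v * norm Z = 1" by (metis complex_mod_cnj norm_minus_cancel norm_mult norm_one)
  moreover have "norm v * norm Z \<le> 1 * norm Z" using assms by (intro mult_right_mono) auto
  ultimately show False using assms by simp
qed

lemma has_vector_derivative_cnj:
  "(f has_vector_derivative f') F \<Longrightarrow> ((\<lambda>t. cnj (f t)) has_vector_derivative cnj f') F"
  by (rule bounded_linear.has_vector_derivative[OF bounded_linear_cnj])

lemma has_vector_derivative_divide_complex:
  fixes f g :: "real \<Rightarrow> complex"
  assumes f: "(f has_vector_derivative f') (at t)" and g: "(g has_vector_derivative g') (at t)"
    and "g t \<noteq> 0"
  shows "((\<lambda>t. f t / g t) has_vector_derivative (f' * g t - f t * g') / (g t)\<^sup>2) (at t)"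
proof -
  have "((inverse \<circ> g) has_vector_derivative g' * (- (inverse (g t) * 1 * inverse (g t)))) (at t)"
    using \<open>g t \<noteq> 0\<close> by (intro field_vector_diff_chain_at g) (auto intro!: derivative_eq_intros)
  from has_vector_derivative_mult[OF f this] show ?thesis
    using \<open>g t \<noteq> 0\<close> by (simp add: o_def field_simps power2_eq_square)
qed

text \<open>The matrices with rows \<open>(\<alpha>, \<beta>)\<close> and \<open>(cnj \<beta>, cnj \<alpha>)\<close> solving the linear equation
  below act on the unit circle by the Riccati flow, and \<open>|\<alpha>|\<^sup>2 - |\<beta>|\<^sup>2\<close> is conserved.  The
  Moebius parameters are \<open>Z = \<beta> / cnj \<alpha>\<close> and \<open>\<zeta> = \<alpha> / cnj \<alpha>\<close>.\<close>

lemma moebius_parameters_exist: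
  fixes F :: "real \<Rightarrow> complex"
  assumes T: "open T" "is_interval T" "t0 \<in> T" and F: "continuous_on T F"
    and "norm Z0 < 1" "norm \<zeta>0 = 1"
  shows "\<exists>Z \<zeta>. Z t0 = Z0 \<and> \<zeta> t0 = \<zeta>0 \<and> (\<forall>t\<in>T. norm (Z t) < 1 \<and> norm (\<zeta> t) = 1 \<and>
    (Z has_vector_derivative F t + \<i> * of_real \<Omega> * Z t - cnj (F t) * (Z t)\<^sup>2) (at t) \<and>
    (\<zeta> has_vector_derivative (\<i> * of_real \<Omega> + F t * cnj (Z t) - cnj (F t) * Z t) * \<zeta> t) (at t))"
proof -
  \<comment> \<open>With pair \<open>(\<alpha>, \<beta>)\<close>, the map \<open>w \<mapsto>
    (\<alpha> w + \<beta>) / (cnj \<beta> w + cnj \<alpha>)\<close> equals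
    \<open>disk_moebius\<close> at the parameters below. Because of the conjugates
    \<open>f t\<close> is linear only over the reals. The rotation rate is halved because quotients
    by \<open>cnj \<alpha>\<close> double the phase.\<close>
  define f where "f t p = (\<i> * of_real \<Omega> / 2 * fst p + F t * cnj (snd p),
      \<i> * of_real \<Omega> / 2 * snd p + F t * cnj (fst p))" for t and p :: "complex \<times> complex"
  \<comment> \<open>For \<open>a0\<close> of modulus 1, \<open>a0 / cnj a0\<close> is the square of
    \<open>a0\<close>, which has to be \<open>\<zeta>0\<close>; the second initial component
    \<open>Z0 * cnj a0\<close> makes the quotient \<open>\<beta> / cnj \<alpha>\<close> start at
    \<open>Z0\<close>.\<close>
  define a0 where "a0 = csqrt \<zeta>0"
  have "\<exists>y. y t0 = (a0, Z0 * cnj a0) \<and> (\<forall>t\<in>T. (y has_vector_derivative f t (y t)) (at t))"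
  proof (rule picard_lindeloef_global[OF T])
    show "continuous_on T (\<lambda>t. f t (y t))" if "continuous_on T y" for y
      unfolding f_def by (intro continuous_intros that F)
    show "\<exists>L. \<forall>t\<in>{a..b}. \<forall>x y. norm (f t x - f t y) \<le> L * norm (x - y)"
      if ab: "{a..b} \<subseteq> T" for a b
    proof -
      have "bounded (F ` {a..b})"
        using continuous_on_subset[OF F ab] by (intro compact_imp_bounded compact_continuous_image) auto
      then obtain M where M: "\<And>t. t \<in> {a..b} \<Longrightarrow> norm (F t) \<le> M"
        unfolding bounded_iff by blast
      define L where "L = \<bar>\<Omega>\<bar> / 2 + M"
      have est: "norm (\<i> * of_real \<Omega> / 2 * u + F t * cnj v) \<le> L * norm p"
        if "t \<in> {a..b}" "norm u \<le> norm p" "norm v \<le> norm p" for t u v and p :: "complex \<times> complex"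
      proof -
        have "norm (\<i> * of_real \<Omega> / 2 * u + F t * cnj v) \<le> \<bar>\<Omega>\<bar> / 2 * norm u + norm (F t) * norm v"
          by (rule order_trans[OF norm_triangle_ineq]) (simp add: norm_mult)
        also have "\<dots> \<le> \<bar>\<Omega>\<bar> / 2 * norm p + M * norm p"
          using M[OF that(1)] that(2,3) order_trans[OF norm_ge_zero M[OF that(1)]]
          by (intro add_mono mult_mono) auto
        finally show ?thesis by (simp add: L_def algebra_simps)
      qed
      \<comment> \<open>The factor 2 comes from bounding the norm of a pair by the sum of the norms
        of its components.\<close>
      have "norm (f t x - f t y) \<le> (2 * L) * norm (x - y)" if "t \<in> {a..b}" for t x y
      proof -
        define p where "p = x - y"
        have "f t x - f t y = f t p"
          by (simp add: p_def f_def algebra_simps diff_divide_distrib)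
        moreover have "norm (f t p) \<le> norm (fst (f t p)) + norm (snd (f t p))"
          using norm_Pair_le[of "fst (f t p)" "snd (f t p)"] by simp
        moreover have "norm (fst (f t p)) \<le> L * norm p" "norm (snd (f t p)) \<le> L * norm p"
          using that norm_fst_le[of "fst p" "snd p"] norm_snd_le[of "snd p" "fst p"]
          unfolding f_def fst_conv snd_conv by (intro est; simp)+
        ultimately show ?thesis by (simp add: p_def)
      qed
      then show ?thesis by blast
    qed
  qed
  then obtain y where y0: "y t0 = (a0, Z0 * cnj a0)"
    and y: "\<And>t. t \<in> T \<Longrightarrow> (y has_vector_derivative f t (y t)) (at t)" by blast
  define \<alpha> \<beta> where "\<alpha> t = fst (y t)" and "\<beta> t = snd (y t)" for t
  have \<alpha>: "(\<alpha> has_vector_derivative \<i> * of_real \<Omega> / 2 * \<alpha> t + F t * cnj (\<beta> t)) (at t)"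
    and \<beta>: "(\<beta> has_vector_derivative \<i> * of_real \<Omega> / 2 * \<beta> t + F t * cnj (\<alpha> t)) (at t)"
    if "t \<in> T" for t
    using bounded_linear.has_vector_derivative[OF bounded_linear_fst y[OF that]]
      bounded_linear.has_vector_derivative[OF bounded_linear_snd y[OF that]]
    by (simp_all add: \<alpha>_def[abs_def] \<beta>_def[abs_def] f_def)
  have a0: "norm a0 = 1"
    using \<open>norm \<zeta>0 = 1\<close> by (simp add: a0_def norm_csqrt)
  \<comment> \<open>The rotation terms cancel within each product, and the \<open>F\<close> terms of
    the two products are equal. The positive value keeps \<open>\<alpha>\<close> away from zero and
    \<open>Z\<close> inside the disk.\<close>
  have conserved: "\<alpha> t * cnj (\<alpha> t) - \<beta> t * cnj (\<beta> t) = 1 - Z0 * cnj Z0" if "t \<in> T" for t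
  proof -
    have "\<alpha> t * cnj (\<alpha> t) - \<beta> t * cnj (\<beta> t) = \<alpha> t0 * cnj (\<alpha> t0) - \<beta> t0 * cnj (\<beta> t0)"
    proof (rule zero_vector_derivative_constant[OF T(2) _ that T(3)])
      fix s assume "s \<in> T"
      note d = \<alpha>[OF this] \<beta>[OF this]
      show "((\<lambda>t. \<alpha> t * cnj (\<alpha> t) - \<beta> t * cnj (\<beta> t)) has_vector_derivative 0) (at s)"
        by (rule has_vector_derivative_eq_rhs, (rule derivative_intros d has_vector_derivative_cnj)+)
          (simp add: algebra_simps)
    qed
    also have "a0 * cnj a0 = 1"
      using a0 by (simp add: complex_norm_square[symmetric])
    then have "\<alpha> t0 * cnj (\<alpha> t0) - \<beta> t0 * cnj (\<beta> t0) = 1 - Z0 * cnj Z0"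
      by (simp add: \<alpha>_def \<beta>_def y0 algebra_simps)
    finally show ?thesis .
  qed
  have norms: "norm (\<beta> t) < norm (\<alpha> t)" if "t \<in> T" for t
  proof -
    have "complex_of_real ((norm (\<alpha> t))\<^sup>2 - (norm (\<beta> t))\<^sup>2) = complex_of_real (1 - (norm Z0)\<^sup>2)"
      using conserved[OF that] by (simp add: complex_norm_square[symmetric])
    then have "(norm (\<alpha> t))\<^sup>2 - (norm (\<beta> t))\<^sup>2 = 1 - (norm Z0)\<^sup>2"
      using of_real_eq_iff by blast
    moreover have "(norm Z0)\<^sup>2 < 1"
      using \<open>norm Z0 < 1\<close> by (simp add: abs_square_less_1)
    ultimately show ?thesis
      by (intro power2_less_imp_less[of "norm (\<beta> t)"]) auto
  qed
  then have nz: "\<alpha> t \<noteq> 0" if "t \<in> T" for t using that by fastforce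
  define Z \<zeta> where "Z t = \<beta> t / cnj (\<alpha> t)" and "\<zeta> t = \<alpha> t / cnj (\<alpha> t)" for t
  have "Z t0 = Z0" "\<zeta> t0 = \<zeta>0"
  proof -
    have "a0 \<noteq> 0" using a0 by auto
    then show "Z t0 = Z0" by (simp add: Z_def \<alpha>_def \<beta>_def y0)
    have "a0 * cnj a0 = 1"
      using a0 by (simp add: complex_norm_square[symmetric])
    then have "cnj a0 = inverse a0"
      using inverse_unique by metis
    then show "\<zeta> t0 = \<zeta>0"
      using power2_csqrt[of \<zeta>0] by (simp add: \<zeta>_def \<alpha>_def y0 a0_def power2_eq_square divide_inverse)
  qed
  moreover have "norm (Z t) < 1 \<and> norm (\<zeta> t) = 1 \<and>
    (Z has_vector_derivative F t + \<i> * of_real \<Omega> * Z t - cnj (F t) * (Z t)\<^sup>2) (at t) \<and>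
    (\<zeta> has_vector_derivative (\<i> * of_real \<Omega> + F t * cnj (Z t) - cnj (F t) * Z t) * \<zeta> t) (at t)"
    if t: "t \<in> T" for t
  proof (intro conjI)
    show "norm (Z t) < 1" "norm (\<zeta> t) = 1"
      using norms[OF t] nz[OF t] by (auto simp: Z_def \<zeta>_def norm_divide)
    have nz': "cnj (\<alpha> t) \<noteq> 0" using nz[OF t] by simp
    show "(Z has_vector_derivative F t + \<i> * of_real \<Omega> * Z t - cnj (F t) * (Z t)\<^sup>2) (at t)"
      unfolding Z_def[abs_def]
      by (rule has_vector_derivative_eq_rhs[OF has_vector_derivative_divide_complex[OF \<beta>[OF t]
              has_vector_derivative_cnj[OF \<alpha>[OF t]] nz']])
        (use nz[OF t] in \<open>simp add: field_simps power2_eq_square\<close>)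
    show "(\<zeta> has_vector_derivative (\<i> * of_real \<Omega> + F t * cnj (Z t) - cnj (F t) * Z t) * \<zeta> t) (at t)"
      unfolding Z_def[abs_def] \<zeta>_def[abs_def]
      by (rule has_vector_derivative_eq_rhs[OF has_vector_derivative_divide_complex[OF \<alpha>[OF t]
              has_vector_derivative_cnj[OF \<alpha>[OF t]] nz']])
        (use nz[OF t] in \<open>simp add: field_simps power2_eq_square\<close>)
  qed
  ultimately show ?thesis by blast
qed

text \<open>With numerator \<open>N\<close> and denominator \<open>D\<close>, the quotient rule
  leaves two terms containing \<open>cnj F\<close>; the identity \<open>*\<close> merges them into
  \<open>cnj F * (N t)\<^sup>2\<close>, the quadratic term of the Riccati equation.\<close>

lemma disk_moebius_riccati:
  assumes Z: "(Z has_vector_derivative F + i\<Omega> * Z t - cnj F * (Z t)\<^sup>2) (at t)"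
    and \<zeta>: "(\<zeta> has_vector_derivative (i\<Omega> + F * cnj (Z t) - cnj F * Z t) * \<zeta> t) (at t)"
    and "cnj i\<Omega> = - i\<Omega>" and "1 + \<zeta> t * cnj (Z t) * w \<noteq> 0"
  shows "((\<lambda>s. disk_moebius (Z s) (\<zeta> s) w) has_vector_derivative
    F + i\<Omega> * disk_moebius (Z t) (\<zeta> t) w - cnj F * (disk_moebius (Z t) (\<zeta> t) w)\<^sup>2) (at t)"
proof -
  define N where "N s = \<zeta> s * w + Z s" for s
  define D where "D s = 1 + \<zeta> s * cnj (Z s) * w" for s
  have N: "(N has_vector_derivative i\<Omega> * N t + F * D t - cnj F * Z t * N t) (at t)"
    unfolding N_def[abs_def] D_def
    by (rule has_vector_derivative_eq_rhs, (rule derivative_intros Z \<zeta>)+)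
      (simp add: algebra_simps power2_eq_square)
  \<comment> \<open>Since \<open>i\<Omega>\<close> is purely imaginary, the rotations of
    \<open>\<zeta>\<close> and \<open>cnj Z\<close> cancel, as do the terms in \<open>F\<close>, and
    only \<open>cnj F\<close> survives.\<close>
  have D: "(D has_vector_derivative \<zeta> t * w * cnj F * (1 - Z t * cnj (Z t))) (at t)"
    unfolding D_def[abs_def]
    by (rule has_vector_derivative_eq_rhs, (rule derivative_intros Z \<zeta> has_vector_derivative_cnj)+)
      (simp add: algebra_simps power2_eq_square \<open>cnj i\<Omega> = - i\<Omega>\<close>)
  have D0: "D t \<noteq> 0" using assms(4) by (simp add: D_def)
  have *: "Z t * D t + \<zeta> t * w * (1 - Z t * cnj (Z t)) = N t"
    by (simp add: N_def D_def algebra_simps)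
  have "(i\<Omega> * N t + F * D t - cnj F * Z t * N t) * D t - N t * (\<zeta> t * w * cnj F * (1 - Z t * cnj (Z t)))
    = i\<Omega> * N t * D t + F * (D t)\<^sup>2 - cnj F * N t * (Z t * D t + \<zeta> t * w * (1 - Z t * cnj (Z t)))"
    by (simp add: algebra_simps power2_eq_square)
  also have "\<dots> / (D t)\<^sup>2 = F + i\<Omega> * (N t / D t) - cnj F * (N t / D t)\<^sup>2"
    using D0 unfolding * by (simp add: field_simps power2_eq_square)
  finally have eq: "((i\<Omega> * N t + F * D t - cnj F * Z t * N t) * D t
      - N t * (\<zeta> t * w * cnj F * (1 - Z t * cnj (Z t)))) / (D t)\<^sup>2
    = F + i\<Omega> * (N t / D t) - cnj F * (N t / D t)\<^sup>2" .
  have "((\<lambda>s. N s / D s) has_vector_derivative F + i\<Omega> * (N t / D t) - cnj F * (N t / D t)\<^sup>2) (at t)"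
    using has_vector_derivative_divide_complex[OF N D D0] unfolding eq .
  then show ?thesis by (simp add: disk_moebius_def N_def D_def)
qed

text \<open>As \<open>x\<^sup>2 - y\<^sup>2 = (x + y) * (x - y)\<close>, the difference of two
  solutions solves a linear homogeneous equation whose coefficient is continuous along these
  solutions.\<close>

lemma riccati_unique:
  fixes x y F i\<Omega> :: "real \<Rightarrow> complex"
  assumes T: "open T" "is_interval T" "s \<in> T" "t \<in> T"
    and F: "continuous_on T F" and G: "continuous_on T G" and i\<Omega>: "continuous_on T i\<Omega>"
    and x: "\<And>t. t \<in> T \<Longrightarrow> (x has_vector_derivative F t + i\<Omega> t * x t - G t * (x t)\<^sup>2) (at t)"
    and y: "\<And>t. t \<in> T \<Longrightarrow> (y has_vector_derivative F t + i\<Omega> t * y t - G t * (y t)\<^sup>2) (at t)"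
    and "x s = y s"
  shows "x t = y t"
proof -
  have cont: "continuous_on T x" "continuous_on T y"
    using x y by (auto intro!: continuous_at_imp_continuous_on has_vector_derivative_continuous)
  have "x t - y t = 0"
  proof (rule linear_ode_zero[OF T, where e = "\<lambda>t. x t - y t" and a = "\<lambda>t. i\<Omega> t - G t * (x t + y t)"])
    show "((\<lambda>t. x t - y t) has_vector_derivative (i\<Omega> t - G t * (x t + y t)) * (x t - y t)) (at t)"
      if "t \<in> T" for t
      by (rule has_vector_derivative_eq_rhs, (rule derivative_intros x y that)+)
        (simp add: algebra_simps power2_eq_square)
    show "continuous_on T (\<lambda>t. i\<Omega> t - G t * (x t + y t))"
      by (intro continuous_intros cont F G i\<Omega>)
  qed (use \<open>x s = y s\<close> in auto)
  then show ?thesis by simp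
qed

section \<open>The Kuramoto vector field\<close>

definition velocity :: "('n::finite, 'x) kuramoto_scheme \<Rightarrow> real ^ 'n \<Rightarrow> 'n \<Rightarrow> real" where
  "velocity K x j = freq K $ j + (\<Sum>k\<in>UNIV. weight K j k * sin (x $ k - x $ j - lag K j k))"

text \<open>With \<open>a = calA K \<gamma>\<close> this is the field F of a cross-ratio part, and
  with \<open>a = Amat K j\<close> the field G of a single vertex, both in the original phases.
  Expressing it in reduced coordinates is what closes the system.\<close>

definition mean_field :: "('n::finite \<Rightarrow> complex) \<Rightarrow> real ^ 'n \<Rightarrow> complex" where
  "mean_field a x = (\<Sum>k\<in>UNIV. a k * cis (x $ k))"

lemma sin_coupling_eq_Im:
  "W * sin (y - x - \<alpha>) = 2 * Im (1 / 2 * of_real W * cis (- \<alpha>) * cis y * cis (- x))"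
proof -
  have "cis (- \<alpha>) * cis y * cis (- x) = cis (y - x - \<alpha>)"
    by (simp add: cis_mult) (simp add: algebra_simps)
  then have "1 / 2 * of_real W * cis (- \<alpha>) * cis y * cis (- x) = of_real (W / 2) * cis (y - x - \<alpha>)"
    by (simp add: mult.assoc)
  then show ?thesis unfolding \<open>1 / 2 * _ * _ * _ * _ = _\<close> by simp
qed

text \<open>In the diagonal term the two phase factors cancel, and twice the imaginary part of the
  diagonal entry of \<open>Amat\<close> is the natural frequency; the other terms are the sine
  couplings.\<close>

lemma velocity_eq_Im_mean_field:
  assumes "weight K j j = 0"
  shows "velocity K x j = 2 * Im (mean_field (Amat K j) x * cis (- (x $ j)))"
proof -
  have "2 * Im (mean_field (Amat K j) x * cis (- (x $ j)))
      = (\<Sum>k\<in>UNIV. 2 * Im (Amat K j k * cis (x $ k) * cis (- (x $ j))))"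
    unfolding mean_field_def sum_distrib_right sum_distrib_left Im_sum ..
  also have "\<dots> = 2 * Im (Amat K j j * cis (x $ j) * cis (- (x $ j)))
      + (\<Sum>k\<in>UNIV - {j}. 2 * Im (Amat K j k * cis (x $ k) * cis (- (x $ j))))"
    by (rule sum.remove) auto
  also have "2 * Im (Amat K j j * cis (x $ j) * cis (- (x $ j))) = freq K $ j"
    by (simp add: Amat_def mult.assoc cis_mult)
  also have "(\<Sum>k\<in>UNIV - {j}. 2 * Im (Amat K j k * cis (x $ k) * cis (- (x $ j))))
      = (\<Sum>k\<in>UNIV - {j}. weight K j k * sin (x $ k - x $ j - lag K j k))"
    by (intro sum.cong refl) (auto simp: Amat_def sin_coupling_eq_Im)
  also have "freq K $ j + \<dots> = velocity K x j"
    unfolding velocity_def using assms by (simp add: sum.remove[of UNIV j])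
  finally show ?thesis ..
qed

text \<open>Rows of one cross-ratio part differ from the common row \<open>calA K \<gamma>\<close>
  in the diagonal entry only. That mismatch multiplies \<open>cis (x $ j)\<close>, whose phase
  cancels, so it contributes a constant rate; the condition on the frequencies makes this rate the
  same \<open>Omega K \<gamma>\<close> for every vertex.\<close>

lemma velocity_part_C:
  assumes K: "partitioned_kuramoto K" and \<gamma>: "\<gamma> \<in> {1..num_C K}" and j: "j \<in> part_C K \<gamma>"
  shows "velocity K x j = Omega K \<gamma> + 2 * Im (mean_field (calA K \<gamma>) x * cis (- (x $ j)))"
proof -
  have row: "weight K j k = C_coef K k \<gamma> \<and> lag K j k = chi K k \<gamma>" if "k \<noteq> j" for k
    using K \<gamma> j that unfolding partitioned_kuramoto_def by blast
  have freq: "freq K $ j = freq K $ ref K \<gamma> + 2 * Im (calA K \<gamma> j - calA K \<gamma> (ref K \<gamma>))"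
    using K \<gamma> j unfolding partitioned_kuramoto_def by blast
  have W0: "weight K j j = 0" using K unfolding partitioned_kuramoto_def by (elim conjE) simp
  have A: "Amat K j k = calA K \<gamma> k" if "k \<noteq> j" for k
    using row[OF that] that by (auto simp: Amat_def calA_def)
  have "mean_field (Amat K j) x - mean_field (calA K \<gamma>) x
      = (\<Sum>k\<in>UNIV. (Amat K j k - calA K \<gamma> k) * cis (x $ k))"
    by (simp add: mean_field_def sum_subtractf algebra_simps)
  also have "\<dots> = (Amat K j j - calA K \<gamma> j) * cis (x $ j)"
    using A by (subst sum.remove[of UNIV j]) auto
  finally have "mean_field (Amat K j) x = mean_field (calA K \<gamma>) x + (Amat K j j - calA K \<gamma> j) * cis (x $ j)"
    by (simp add: algebra_simps)
  then have "velocity K x j = 2 * Im (mean_field (calA K \<gamma>) x * cis (- (x $ j)))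
      + 2 * Im ((Amat K j j - calA K \<gamma> j) * (cis (x $ j) * cis (- (x $ j))))"
    by (simp add: velocity_eq_Im_mean_field[of K j x, OF W0] distrib_right mult.assoc)
  also have "2 * Im ((Amat K j j - calA K \<gamma> j) * (cis (x $ j) * cis (- (x $ j)))) = Omega K \<gamma>"
    by (simp add: cis_mult Amat_def Omega_def freq field_simps)
  finally show ?thesis by simp
qed

lemma has_vector_derivative_cis_of:
  assumes "(\<theta> has_real_derivative d) (at t)"
  shows "((\<lambda>s. cis (\<theta> s)) has_vector_derivative \<i> * of_real d * cis (\<theta> t)) (at t)"
proof -
  have "((\<lambda>s. \<i> * of_real (\<theta> s)) has_vector_derivative \<i> * of_real d) (at t)"
    using assms unfolding has_real_derivative_iff_has_vector_derivative
    by (intro has_vector_derivative_mult_right bounded_linear.has_vector_derivative[OF bounded_linear_of_real])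
  from field_vector_diff_chain_at[OF this DERIV_exp]
  show ?thesis by (simp add: o_def cis_conv_exp mult.commute)
qed

text \<open>With \<open>u = F * cis (- x)\<close>, the factor \<open>2 * Im u\<close> becomes
  \<open>u - cnj u\<close> after multiplication by \<open>\<i>\<close>, and multiplying by
  \<open>cis x\<close> gives the two \<open>F\<close> terms. This passes from phase equations to
  equations for points of the circle.\<close>

lemma rotation_eq_riccati:
  "\<i> * of_real (\<Omega> + 2 * Im (F * cis (- x))) * cis x = F + \<i> * of_real \<Omega> * cis x - cnj F * (cis x)\<^sup>2"
proof -
  define u where "u = F * cis (- x)"
  have "(u - cnj u) * cis x = F * (cis (- x) * cis x) - cnj F * (cis x)\<^sup>2"
    by (simp add: u_def cis_cnj algebra_simps power2_eq_square)
  also have "cis (- x) * cis x = 1" by (simp add: cis_mult)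
  finally have *: "(u - cnj u) * cis x = F - cnj F * (cis x)\<^sup>2" by simp
  have "\<i> * of_real (2 * Im u) = u - cnj u"
    by (simp add: complex_eq_iff)
  then have "\<i> * of_real (\<Omega> + 2 * Im u) * cis x = \<i> * of_real \<Omega> * cis x + (u - cnj u) * cis x"
    by (simp only: of_real_add distrib_left distrib_right)
  then show ?thesis unfolding * by (simp add: u_def)
qed

lemma kuramoto_solution_deriv:
  assumes "kuramoto_solution K T \<theta>" "t \<in> T"
  shows "((\<lambda>s. \<theta> s $ j) has_real_derivative velocity K (\<theta> t) j) (at t)"
  using assms by (simp add: kuramoto_solution_def velocity_def)

lemma kuramoto_solution_continuous_on:
  assumes "kuramoto_solution K T \<theta>"
  shows "continuous_on T (\<lambda>t. \<theta> t $ j)"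
  using kuramoto_solution_deriv[OF assms]
  by (intro continuous_at_imp_continuous_on) (auto intro: DERIV_isCont)

lemma mean_field_continuous_on:
  assumes "kuramoto_solution K T \<theta>"
  shows "continuous_on T (\<lambda>t. mean_field a (\<theta> t))"
  unfolding mean_field_def
  by (intro continuous_intros kuramoto_solution_continuous_on[OF assms])

section \<open>Monomial parts\<close>

lemma antisymmetric_double_sum_zero:
  fixes f :: "'a \<Rightarrow> 'a \<Rightarrow> real"
  assumes "\<And>j k. j \<in> A \<Longrightarrow> k \<in> A \<Longrightarrow> f j k = - f k j"
  shows "(\<Sum>j\<in>A. \<Sum>k\<in>A. f j k) = 0"
proof -
  have "(\<Sum>j\<in>A. \<Sum>k\<in>A. f j k) = (\<Sum>j\<in>A. \<Sum>k\<in>A. - f k j)"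
    by (intro sum.cong refl assms)
  also have "\<dots> = - (\<Sum>j\<in>A. \<Sum>k\<in>A. f j k)"
    by (subst sum.swap) (simp add: sum_negf)
  finally show ?thesis by simp
qed

lemma velocity_part_M:
  assumes K: "partitioned_kuramoto K" and \<tau>: "\<tau> \<in> {1..num_M K}" and j: "j \<in> part_M K \<tau>"
  shows "velocity K x j = freq K $ j
    + (\<Sum>k\<in>part_M K \<tau>. S_coef K j k / mu_coef K \<tau> j * sin (x $ k - x $ j - kappa K j k))"
proof -
  have row: "k \<in> part_M K \<tau> \<Longrightarrow> weight K j k = S_coef K j k / mu_coef K \<tau> j"
    "k \<in> part_M K \<tau> \<Longrightarrow> lag K j k = kappa K j k"
    "k \<notin> part_M K \<tau> \<Longrightarrow> weight K j k = 0" for k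
    using K \<tau> j unfolding partitioned_kuramoto_def by blast+
  have "(\<Sum>k\<in>UNIV. weight K j k * sin (x $ k - x $ j - lag K j k))
      = (\<Sum>k\<in>part_M K \<tau>. S_coef K j k / mu_coef K \<tau> j * sin (x $ k - x $ j - kappa K j k))"
    by (rule sum.mono_neutral_cong_right) (auto simp: row)
  then show ?thesis by (simp add: velocity_def)
qed

text \<open>The weight \<open>mu_coef\<close> cancels the divisor in the coupling. What remains is
  odd under exchange of \<open>j\<close> and \<open>k\<close>, because \<open>S_coef\<close> is
  symmetric, \<open>kappa\<close> antisymmetric and the sine odd.\<close>

lemma mu_vec_inner_velocity:
  assumes K: "partitioned_kuramoto K" and \<tau>: "\<tau> \<in> {1..num_M K}"
  shows "(\<Sum>j\<in>UNIV. mu_vec K \<tau> $ j * velocity K x j) = omega_tilde K \<tau>"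
proof -
  have mu0: "mu_coef K \<tau> j \<noteq> 0" if "j \<in> part_M K \<tau>" for j
    using K \<tau> that unfolding partitioned_kuramoto_def by blast
  have mu: "S_coef K j k = S_coef K k j" "kappa K j k = - kappa K k j"
    if "j \<in> part_M K \<tau>" "k \<in> part_M K \<tau>" for j k
    using K \<tau> that unfolding partitioned_kuramoto_def by blast+
  have "(\<Sum>j\<in>UNIV. mu_vec K \<tau> $ j * velocity K x j)
      = (\<Sum>j\<in>part_M K \<tau>. mu_coef K \<tau> j * velocity K x j)"
    by (rule sum.mono_neutral_cong_right) (auto simp: mu_vec_def)
  also have "\<dots> = (\<Sum>j\<in>part_M K \<tau>. mu_coef K \<tau> j * freq K $ j)
      + (\<Sum>j\<in>part_M K \<tau>. \<Sum>k\<in>part_M K \<tau>. S_coef K j k * sin (x $ k - x $ j - kappa K j k))"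
    unfolding sum.distrib[symmetric]
    by (intro sum.cong refl) (simp add: velocity_part_M[OF K \<tau>] mu0 distrib_left sum_distrib_left)
  also have "(\<Sum>j\<in>part_M K \<tau>. \<Sum>k\<in>part_M K \<tau>. S_coef K j k * sin (x $ k - x $ j - kappa K j k)) = 0"
  proof (rule antisymmetric_double_sum_zero)
    fix j k assume "j \<in> part_M K \<tau>" "k \<in> part_M K \<tau>"
    then have "S_coef K j k = S_coef K k j" "x $ k - x $ j - kappa K j k = - (x $ j - x $ k - kappa K k j)"
      using mu[of j k] by auto
    then show "S_coef K j k * sin (x $ k - x $ j - kappa K j k)
        = - (S_coef K k j * sin (x $ j - x $ k - kappa K k j))"
      by (metis mult_minus_right sin_minus)
  qed
  also have "(\<Sum>j\<in>part_M K \<tau>. mu_coef K \<tau> j * freq K $ j) = omega_tilde K \<tau>"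
    unfolding omega_tilde_def inner_vec_def
    by (rule sum.mono_neutral_cong_left) (auto simp: mu_vec_def)
  finally show ?thesis by simp
qed

text \<open>Each projection grows at its own constant rate, and weighting it by the rate of the
  other cancels the growth. Arbitrary pairs are allowed: consecutive parts give \<open>nu\<close>,
  while functional independence uses pairs with one fixed member.\<close>

lemma mu_combination_constant:
  assumes K: "partitioned_kuramoto K" and \<sigma>: "\<sigma> \<in> {1..num_M K}" and \<tau>: "\<tau> \<in> {1..num_M K}"
  shows "constant_of_motion K
    (\<lambda>x. (omega_tilde K \<tau> *\<^sub>R mu_vec K \<sigma> - omega_tilde K \<sigma> *\<^sub>R mu_vec K \<tau>) \<bullet> x)"
  unfolding constant_of_motion_def
proof (intro allI impI ballI)
  fix T \<theta> s t assume sol: "kuramoto_solution K T \<theta>" and st: "s \<in> T" "t \<in> T"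
  let ?v = "omega_tilde K \<tau> *\<^sub>R mu_vec K \<sigma> - omega_tilde K \<sigma> *\<^sub>R mu_vec K \<tau>"
  have "is_interval T" using sol by (simp add: kuramoto_solution_def)
  then show "?v \<bullet> \<theta> s = ?v \<bullet> \<theta> t"
  proof (rule zero_vector_derivative_constant[OF _ _ st])
    fix t assume t: "t \<in> T"
    have "((\<lambda>s. \<Sum>j\<in>UNIV. ?v $ j * \<theta> s $ j) has_real_derivative
        (\<Sum>j\<in>UNIV. ?v $ j * velocity K (\<theta> t) j)) (at t)"
      by (intro DERIV_sum DERIV_cmult kuramoto_solution_deriv[OF sol t])
    also have "(\<Sum>j\<in>UNIV. ?v $ j * velocity K (\<theta> t) j)
      = omega_tilde K \<tau> * (\<Sum>j\<in>UNIV. mu_vec K \<sigma> $ j * velocity K (\<theta> t) j)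
        - omega_tilde K \<sigma> * (\<Sum>j\<in>UNIV. mu_vec K \<tau> $ j * velocity K (\<theta> t) j)"
      by (simp add: left_diff_distrib sum_subtractf sum_distrib_left mult.assoc)
    also have "\<dots> = 0"
      by (simp add: mu_vec_inner_velocity[OF K \<sigma>] mu_vec_inner_velocity[OF K \<tau>])
    finally show "((\<lambda>s. ?v \<bullet> \<theta> s) has_vector_derivative 0) (at t)"
      by (simp add: inner_vec_def has_real_derivative_iff_has_vector_derivative)
  qed
qed

section \<open>The partition and the linear change of coordinates on the monomial parts\<close>

lemma is_partitionD:
  assumes "partitioned_kuramoto K"
  shows "all_M K \<union> (\<Union>\<gamma>\<in>{1..num_C K}. part_C K \<gamma>) \<union> part_P K = UNIV"
    "disjoint_family_on (part_M K) {1..num_M K}"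
    "disjoint_family_on (part_C K) {1..num_C K}"
    "all_M K \<inter> (\<Union>\<gamma>\<in>{1..num_C K}. part_C K \<gamma>) = {}"
    "all_M K \<inter> part_P K = {}"
    "(\<Union>\<gamma>\<in>{1..num_C K}. part_C K \<gamma>) \<inter> part_P K = {}"
    "\<tau> \<in> {1..num_M K} \<Longrightarrow> card (part_M K \<tau>) \<ge> 1"
    "\<gamma> \<in> {1..num_C K} \<Longrightarrow> card (part_C K \<gamma>) \<ge> 4"
proof -
  have P: "is_partition K" using assms unfolding partitioned_kuramoto_def by (elim conjE)
  note P = P[unfolded is_partition_def]
  show "all_M K \<union> (\<Union>\<gamma>\<in>{1..num_C K}. part_C K \<gamma>) \<union> part_P K = UNIV"
    "disjoint_family_on (part_M K) {1..num_M K}"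
    "disjoint_family_on (part_C K) {1..num_C K}"
    "all_M K \<inter> (\<Union>\<gamma>\<in>{1..num_C K}. part_C K \<gamma>) = {}"
    "all_M K \<inter> part_P K = {}"
    "(\<Union>\<gamma>\<in>{1..num_C K}. part_C K \<gamma>) \<inter> part_P K = {}"
    by (simp_all only: P)
  show "\<tau> \<in> {1..num_M K} \<Longrightarrow> card (part_M K \<tau>) \<ge> 1"
    using P by (elim conjE) (erule (1) bspec)
  show "\<gamma> \<in> {1..num_C K} \<Longrightarrow> card (part_C K \<gamma>) \<ge> 4"
    using P by (elim conjE) (erule (1) bspec)
qed

lemma part_M_subset_all_M: "\<tau> \<in> {1..num_M K} \<Longrightarrow> part_M K \<tau> \<subseteq> all_M K"
  by (auto simp: all_M_def)

lemma part_M_unique: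
  assumes "partitioned_kuramoto K" "\<sigma> \<in> {1..num_M K}" "\<tau> \<in> {1..num_M K}"
    and "j \<in> part_M K \<sigma>" "j \<in> part_M K \<tau>"
  shows "\<sigma> = \<tau>"
  using is_partitionD(2)[OF assms(1)] assms(2-) unfolding disjoint_family_on_def by blast

lemma j_max_in_part_M:
  assumes "partitioned_kuramoto K" "\<tau> \<in> {1..num_M K}"
  shows "j_max K \<tau> \<in> part_M K \<tau>"
proof -
  have "part_M K \<tau> \<noteq> {}" using is_partitionD(7)[OF assms] by auto
  then show ?thesis by (simp add: j_max_def)
qed

lemma j_max_eq_iff:
  assumes K: "partitioned_kuramoto K" and "\<sigma> \<in> {1..num_M K}" "\<tau> \<in> {1..num_M K}"
  shows "j_max K \<sigma> = j_max K \<tau> \<longleftrightarrow> \<sigma> = \<tau>"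
  using part_M_unique[OF K assms(2,3)] j_max_in_part_M[OF K] assms(2,3) by metis

lemma inj_on_j_max: "partitioned_kuramoto K \<Longrightarrow> inj_on (j_max K) {1..num_M K}"
  by (intro inj_onI) (metis j_max_eq_iff)

lemma elim_M_subset_all_M:
  assumes "partitioned_kuramoto K"
  shows "elim_M K \<subseteq> all_M K"
proof
  fix j assume "j \<in> elim_M K"
  then obtain \<eta> where "j = j_max K \<eta>" "\<eta> \<in> {1..num_M K}"
    by (auto simp: elim_M_def)
  then show "j \<in> all_M K"
    using j_max_in_part_M[OF assms] part_M_subset_all_M by blast
qed

text \<open>Disjoint parts have distinct maxima, so the definite description inside
  \<open>phi\<close> recovers the index.\<close>

lemma phi_j_max:
  assumes K: "partitioned_kuramoto K" and \<eta>: "\<eta> \<in> {1..<num_M K}"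
  shows "phi K x (j_max K \<eta>) = nu K \<eta> \<bullet> x"
proof -
  have "(THE \<eta>'. \<eta>' \<in> {1..<num_M K} \<and> j_max K \<eta>' = j_max K \<eta>) = \<eta>"
    using \<eta> j_max_eq_iff[OF K] by (intro the_equality) auto
  then show ?thesis using \<eta> by (auto simp: phi_def elim_M_def)
qed

lemma phi_not_elim_M: "j \<notin> elim_M K \<Longrightarrow> phi K x j = x $ j"
  by (simp add: phi_def)

text \<open>\<open>phi\<close> is linear on the whole space, but on monomial vertices it only
  involves monomial coordinates, since \<open>nu\<close> vanishes elsewhere. The square matrix on
  \<open>all_M K\<close> therefore determines it.\<close>

lemma phi_eq_Vmat_sum:
  assumes K: "partitioned_kuramoto K" and j: "j \<in> all_M K"
  shows "phi K x j = (\<Sum>k\<in>all_M K. Vmat K j k * x $ k)"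
proof (cases "j \<in> elim_M K")
  case True
  then obtain \<eta> where \<eta>: "\<eta> \<in> {1..<num_M K}" "j = j_max K \<eta>" by (auto simp: elim_M_def)
  have zero: "nu K \<eta> $ k = 0" if "k \<notin> all_M K" for k
  proof -
    have "\<eta> \<in> {1..num_M K}" "\<eta> + 1 \<in> {1..num_M K}" using \<eta>(1) by auto
    then have "k \<notin> part_M K \<eta>" "k \<notin> part_M K (\<eta> + 1)"
      using that part_M_subset_all_M by blast+
    then show ?thesis by (simp add: nu_def mu_vec_def)
  qed
  have "phi K x j = (\<Sum>k\<in>UNIV. nu K \<eta> $ k * x $ k)"
    by (simp add: \<eta>(2) phi_j_max[OF K \<eta>(1)] inner_vec_def)
  also have "\<dots> = (\<Sum>k\<in>all_M K. nu K \<eta> $ k * x $ k)"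
    by (rule sum.mono_neutral_right) (auto simp: zero)
  also have "\<dots> = (\<Sum>k\<in>all_M K. Vmat K j k * x $ k)"
    unfolding Vmat_def \<eta>(2) phi_j_max[OF K \<eta>(1)] by (simp add: inner_axis)
  finally show ?thesis .
next
  case False
  then have "(\<Sum>k\<in>all_M K. Vmat K j k * x $ k) = (\<Sum>k\<in>all_M K. if k = j then x $ j else 0)"
    by (intro sum.cong refl) (auto simp: Vmat_def phi_not_elim_M axis_def)
  then show ?thesis
    using j False by (simp add: phi_not_elim_M)
qed

text \<open>Inverting the change of coordinates recovers the eliminated phase from all
  \<open>phi\<close> values. Splitting the sum separates the contribution of the conserved
  coordinates, which is \<open>kappa0\<close>, from that of the kept phases.\<close>

lemma j_max_coordinate:
  assumes K: "partitioned_kuramoto K" and \<eta>: "\<eta> \<in> {1..<num_M K}"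
    and Vi: "inverse_matrix_on (all_M K) (Vmat K) Vi"
  shows "x $ j_max K \<eta> = kappa0 K Vi x \<eta> + (\<Sum>l\<in>kept_M K. Vi (j_max K \<eta>) l * phi K x l)"
proof -
  let ?j = "j_max K \<eta>"
  have j: "?j \<in> all_M K" using elim_M_subset_all_M[OF K] \<eta> by (auto simp: elim_M_def)
  have "(\<Sum>l\<in>all_M K. Vi ?j l * phi K x l)
      = (\<Sum>l\<in>all_M K. \<Sum>k\<in>all_M K. Vi ?j l * Vmat K l k * x $ k)"
    by (intro sum.cong refl) (simp add: phi_eq_Vmat_sum[OF K] sum_distrib_left mult.assoc)
  also have "\<dots> = (\<Sum>k\<in>all_M K. (\<Sum>l\<in>all_M K. Vi ?j l * Vmat K l k) * x $ k)"
    by (subst sum.swap) (simp add: sum_distrib_right)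
  also have "\<dots> = (\<Sum>k\<in>all_M K. if k = ?j then x $ ?j else 0)"
    using Vi j by (intro sum.cong refl) (auto simp: inverse_matrix_on_def)
  also have "\<dots> = x $ ?j" using j by simp
  finally have "x $ ?j = (\<Sum>l\<in>all_M K. Vi ?j l * phi K x l)" ..
  also have "\<dots> = (\<Sum>l\<in>elim_M K. Vi ?j l * phi K x l) + (\<Sum>l\<in>kept_M K. Vi ?j l * phi K x l)"
    unfolding kept_M_def using sum.subset_diff[OF elim_M_subset_all_M[OF K]]
    by (simp add: add.commute)
  also have "(\<Sum>l\<in>elim_M K. Vi ?j l * phi K x l) = kappa0 K Vi x \<eta>"
  proof -
    have "inj_on (j_max K) {1..<num_M K}"
      using inj_on_j_max[OF K] by (rule inj_on_subset) auto
    then show ?thesis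
      unfolding elim_M_def kappa0_def by (simp add: sum.reindex phi_j_max[OF K])
  qed
  finally show ?thesis .
qed

lemma nu_inner_constant:
  assumes K: "partitioned_kuramoto K" and sol: "kuramoto_solution K T \<theta>"
    and \<eta>: "\<eta> \<in> {1..<num_M K}" and "s \<in> T" "t \<in> T"
  shows "nu K \<eta> \<bullet> \<theta> s = nu K \<eta> \<bullet> \<theta> t"
proof -
  have "\<eta> \<in> {1..num_M K}" "\<eta> + 1 \<in> {1..num_M K}" using \<eta> by auto
  from mu_combination_constant[OF K this] show ?thesis
    using sol assms(4,5) unfolding constant_of_motion_def nu_def by blast
qed

text \<open>\<open>kappa0\<close> is built from conserved quantities, so the reference time
  \<open>s\<close> is arbitrary. The exponents in the monomial are real rather than integers, hence
  the identity is derived for the real phases before exponentiating.\<close>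

lemma cis_j_max:
  assumes K: "partitioned_kuramoto K" and sol: "kuramoto_solution K T \<theta>"
    and \<eta>: "\<eta> \<in> {1..<num_M K}" and Vi: "inverse_matrix_on (all_M K) (Vmat K) Vi"
    and "s \<in> T" "t \<in> T"
  shows "cis (\<theta> t $ j_max K \<eta>) = cis (kappa0 K Vi (\<theta> s) \<eta>) * xi_mono K Vi (phi K (\<theta> t)) \<eta>"
proof -
  have "kappa0 K Vi (\<theta> t) \<eta> = kappa0 K Vi (\<theta> s) \<eta>"
    unfolding kappa0_def by (intro sum.cong refl) (metis nu_inner_constant[OF K sol] assms(5,6))
  then show ?thesis
    unfolding xi_mono_def cis_conv_exp[symmetric]
    by (simp add: j_max_coordinate[OF K \<eta> Vi, of "\<theta> t"] cis_mult)
qed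

text \<open>The sum over all vertices is split into kept and eliminated monomial vertices,
  cross-ratio parts and the rest, and each phase factor is replaced by its reduced expression. This
  is the closure of the reduced system.\<close>

lemma coupling_eq_mean_field:
  assumes K: "partitioned_kuramoto K"
    and elim: "\<And>\<epsilon>. \<epsilon> \<in> {1..<num_M K} \<Longrightarrow> cis (x $ j_max K \<epsilon>) = cis (\<kappa>0 \<epsilon>) * xi_mono K Vi (phi K x) \<epsilon>"
    and C: "\<And>\<delta> k. \<delta> \<in> {1..num_C K} \<Longrightarrow> k \<in> part_C K \<delta> \<Longrightarrow> cis (x $ k) = disk_moebius (Z \<delta>) (\<zeta> \<delta>) (w k)"
  shows "coupling K Vi \<kappa>0 w a (phi K x) Z \<zeta> (\<lambda>k. cis (x $ k)) = mean_field a x"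
proof -
  let ?g = "\<lambda>k. a k * cis (x $ k)" and ?C = "\<Union>\<gamma>\<in>{1..num_C K}. part_C K \<gamma>"
  note p = is_partitionD[OF K]
  have "mean_field a x = sum ?g (all_M K \<union> ?C \<union> part_P K)"
    unfolding mean_field_def p(1) ..
  also have "\<dots> = sum ?g (all_M K \<union> ?C) + sum ?g (part_P K)"
    using p(5,6) by (intro sum.union_disjoint) auto
  also have "sum ?g (all_M K \<union> ?C) = sum ?g (all_M K) + sum ?g ?C"
    using p(4) by (intro sum.union_disjoint) auto
  also have "sum ?g (all_M K) = sum ?g (kept_M K) + sum ?g (elim_M K)"
    unfolding kept_M_def using elim_M_subset_all_M[OF K] by (intro sum.subset_diff) auto
  also have "sum ?g (kept_M K) = (\<Sum>k\<in>kept_M K. a k * cis (phi K x k))"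
    by (intro sum.cong refl) (simp add: kept_M_def phi_not_elim_M)
  also have "sum ?g (elim_M K) = (\<Sum>\<epsilon>\<in>{1..<num_M K}. a (j_max K \<epsilon>) * cis (\<kappa>0 \<epsilon>) * xi_mono K Vi (phi K x) \<epsilon>)"
  proof -
    have "inj_on (j_max K) {1..<num_M K}"
      using inj_on_j_max[OF K] by (rule inj_on_subset) auto
    then show ?thesis
      unfolding elim_M_def by (simp add: sum.reindex elim mult.assoc)
  qed
  also have "sum ?g ?C = (\<Sum>\<delta>\<in>{1..num_C K}. \<Sum>k\<in>part_C K \<delta>. ?g k)"
    using p(3) by (intro sum.UNION_disjoint) (auto simp: disjoint_family_on_def)
  also have "\<dots> = (\<Sum>\<delta>\<in>{1..num_C K}. \<Sum>k\<in>part_C K \<delta>. a k * disk_moebius (Z \<delta>) (\<zeta> \<delta>) (w k))"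
    by (intro sum.cong refl) (simp add: C)
  finally show ?thesis by (simp add: coupling_def add.assoc)
qed

lemma velocity_part_M_complex:
  assumes K: "partitioned_kuramoto K" and \<tau>: "\<tau> \<in> {1..num_M K}" and j: "j \<in> part_M K \<tau>"
  shows "\<i> * of_real (velocity K x j) * cis (x $ j) = \<i> * of_real (freq K $ j) * cis (x $ j)
    + 1 / (2 * of_real (mu_coef K \<tau> j)) * (\<Sum>k\<in>part_M K \<tau>. of_real (S_coef K j k) *
        (cis (x $ k) * cis (- kappa K j k) - cnj (cis (x $ k)) * (cis (x $ j))\<^sup>2 * cis (kappa K j k)))"
proof -
  \<comment> \<open>One summand, by Euler's formula: multiplying by \<open>cis u\<close> turns the
    conjugate half of the sine into a phase \<open>2 * u + k - y\<close>, whence the square of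
    \<open>cis u\<close>.\<close>
  have *: "\<i> * of_real (s / m * sin (y - u - k)) * cis u
      = 1 / (2 * of_real m) * (of_real s * (cis y * cis (- k) - cnj (cis y) * (cis u)\<^sup>2 * cis k))"
    for s m y u k :: real
  proof -
    have sine: "\<i> * of_real (2 * sin d) = cis d - cis (- d)" for d
      by (simp add: complex_eq_iff)
    have "\<i> * of_real (2 * sin (y - u - k)) * cis u = cis (y - k) - cis (2 * u + k - y)"
      unfolding sine by (simp add: left_diff_distrib cis_mult) (simp add: algebra_simps)
    also have "\<dots> = cis y * cis (- k) - cnj (cis y) * (cis u)\<^sup>2 * cis k"
      by (simp add: cis_cnj cis_mult power2_eq_square algebra_simps)
    finally have "\<i> * of_real (2 * sin (y - u - k)) * cis u
      = cis y * cis (- k) - cnj (cis y) * (cis u)\<^sup>2 * cis k" .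
    from this[symmetric] show ?thesis by (simp only:) simp
  qed
  have "\<i> * of_real (velocity K x j) * cis (x $ j) = \<i> * of_real (freq K $ j) * cis (x $ j)
    + (\<Sum>k\<in>part_M K \<tau>. \<i> * of_real (S_coef K j k / mu_coef K \<tau> j * sin (x $ k - x $ j - kappa K j k)) * cis (x $ j))"
    unfolding velocity_part_M[OF K \<tau> j] of_real_add of_real_sum
    by (simp only: distrib_left distrib_right sum_distrib_left sum_distrib_right)
  also have "(\<Sum>k\<in>part_M K \<tau>. \<i> * of_real (S_coef K j k / mu_coef K \<tau> j * sin (x $ k - x $ j - kappa K j k)) * cis (x $ j))
    = 1 / (2 * of_real (mu_coef K \<tau> j)) * (\<Sum>k\<in>part_M K \<tau>. of_real (S_coef K j k) *
        (cis (x $ k) * cis (- kappa K j k) - cnj (cis (x $ k)) * (cis (x $ j))\<^sup>2 * cis (kappa K j k)))"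
    unfolding sum_distrib_left by (intro sum.cong refl *)
  finally show ?thesis .
qed

section \<open>Cross-ratios\<close>

text \<open>Up to the factor \<open>2 * \<i> * cis ((x $ j + x $ k) / 2)\<close> this is the chord
  \<open>cis (x $ j) - cis (x $ k)\<close>, so it vanishes exactly when the two points of the circle
  coincide.\<close>

definition half_sine :: "'n \<Rightarrow> 'n \<Rightarrow> real ^ 'n \<Rightarrow> real" where
  "half_sine j k x = sin ((x $ j - x $ k) / 2)"

text \<open>The phase factors of the four chords cancel, so this equals the usual complex
  cross-ratio of the four points, which is real on the circle.\<close>

definition cross_ratio :: "'n \<Rightarrow> 'n \<Rightarrow> 'n \<Rightarrow> 'n \<Rightarrow> real ^ 'n \<Rightarrow> real" where
  "cross_ratio j a b c x = (half_sine j a x * half_sine b c x) / (half_sine j b x * half_sine a c x)"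

text \<open>The logarithmic derivative of each half-angle sine splits into a sum of two terms, one
  for each of its vertices; these cancel in the cross-ratio.\<close>

lemma half_sine_evolution:
  assumes K: "partitioned_kuramoto K" and \<gamma>: "\<gamma> \<in> {1..num_C K}"
    and sol: "kuramoto_solution K T \<theta>" and s: "s \<in> T" and t: "t \<in> T"
  shows "\<exists>h. \<forall>j\<in>part_C K \<gamma>. \<forall>k\<in>part_C K \<gamma>.
    half_sine j k (\<theta> s) = half_sine j k (\<theta> t) * (exp (h j) * exp (h k))"
proof -
  have T: "open T" "is_interval T" using sol by (auto simp: kuramoto_solution_def)
  define F where "F t = mean_field (calA K \<gamma>) (\<theta> t)" for t
  \<comment> \<open>The share of vertex \<open>j\<close> in the logarithmic derivative, with sign
    reversed; the common rotation rate drops out of the velocity difference.\<close>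
  define g where "g j t = Re (cnj (F t) * cis (\<theta> t $ j))" for j t
  have "continuous_on T (g j)" for j
    unfolding g_def F_def
    by (intro continuous_intros mean_field_continuous_on[OF sol] kuramoto_solution_continuous_on[OF sol])
  then have "\<exists>A. \<forall>t\<in>T. (A has_vector_derivative g j t) (at t)" for j
    using antiderivative_on_open_interval[OF T s] by blast
  then obtain A where A: "\<And>j t. t \<in> T \<Longrightarrow> (A j has_vector_derivative g j t) (at t)"
    by metis
  \<comment> \<open>In terms of half sum and half difference of the two angles this is a consequence
    of the addition formulas.\<close>
  have trig: "cos ((a - b) / 2) * (Im (f * cis (- a)) - Im (f * cis (- b)))
      = - (Re (cnj f * cis a) + Re (cnj f * cis b)) * sin ((a - b) / 2)" for a b f
  proof -
    define u v where "u = (a + b) / 2" and "v = (a - b) / 2"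
    have ab: "a = u + v" "b = u - v" "(a - b) / 2 = v" by (auto simp: u_def v_def field_simps)
    have "cos v * (Im (f * cis (- (u + v))) - Im (f * cis (- (u - v))))
        = - (Re (cnj f * cis (u + v)) + Re (cnj f * cis (u - v))) * sin v"
      by (simp add: sin_add cos_add sin_diff cos_diff algebra_simps)
    then show ?thesis
      unfolding ab(3) unfolding ab(1,2) .
  qed
  \<comment> \<open>The double minus is the integrating factor \<open>exp (- A)\<close> for the
    antiderivative \<open>- (A j t + A k t)\<close>. As this is a sum over the two vertices, the
    factor splits into one per vertex.\<close>
  have "half_sine j k (\<theta> s) * exp (- (- (A j s + A k s))) = half_sine j k (\<theta> t) * exp (- (- (A j t + A k t)))"
    if j: "j \<in> part_C K \<gamma>" and k: "k \<in> part_C K \<gamma>" for j k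
  proof (rule linear_ode_integrating_factor[OF T(2) s t, where e = "\<lambda>t. half_sine j k (\<theta> t)"
        and a = "\<lambda>t. - (g j t + g k t)"])
    fix t assume t: "t \<in> T"
    have "((\<lambda>t. half_sine j k (\<theta> t)) has_real_derivative
        cos ((\<theta> t $ j - \<theta> t $ k) / 2) * ((velocity K (\<theta> t) j - velocity K (\<theta> t) k) / 2)) (at t)"
      unfolding half_sine_def
      by (intro DERIV_fun_sin DERIV_cdivide DERIV_diff kuramoto_solution_deriv[OF sol t])
    also have "cos ((\<theta> t $ j - \<theta> t $ k) / 2) * ((velocity K (\<theta> t) j - velocity K (\<theta> t) k) / 2)
        = - (g j t + g k t) * half_sine j k (\<theta> t)"
      using trig[of "\<theta> t $ j" "\<theta> t $ k" "F t"]
      by (simp add: velocity_part_C[OF K \<gamma> j] velocity_part_C[OF K \<gamma> k] F_def g_def half_sine_def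
          diff_divide_distrib)
    finally show "((\<lambda>t. half_sine j k (\<theta> t)) has_vector_derivative
        - (g j t + g k t) * half_sine j k (\<theta> t)) (at t)"
      by (simp only: has_real_derivative_iff_has_vector_derivative)
    show "((\<lambda>t. - (A j t + A k t)) has_vector_derivative - (g j t + g k t)) (at t)"
      by (intro derivative_intros A t)
  qed
  then have "half_sine j k (\<theta> s) = half_sine j k (\<theta> t) * (exp (A j t - A j s) * exp (A k t - A k s))"
    if "j \<in> part_C K \<gamma>" "k \<in> part_C K \<gamma>" for j k
    using that by (simp add: exp_add exp_diff field_simps)
  then show ?thesis by (intro exI[of _ "\<lambda>j. A j t - A j s"]) simp
qed

text \<open>Each of the four vertices occurs once above and once below the fraction bar, so
  numerator and denominator acquire the same factor \<open>e\<close>.\<close>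

lemma cross_ratio_constant:
  assumes K: "partitioned_kuramoto K" and \<gamma>: "\<gamma> \<in> {1..num_C K}"
    and mem: "j \<in> part_C K \<gamma>" "a \<in> part_C K \<gamma>" "b \<in> part_C K \<gamma>" "c \<in> part_C K \<gamma>"
  shows "constant_of_motion K (cross_ratio j a b c)"
  unfolding constant_of_motion_def
proof (intro allI impI ballI)
  fix T \<theta> s t assume sol: "kuramoto_solution K T \<theta>" and st: "s \<in> T" "t \<in> T"
  obtain h where h: "\<And>p q. p \<in> part_C K \<gamma> \<Longrightarrow> q \<in> part_C K \<gamma> \<Longrightarrow>
      half_sine p q (\<theta> s) = half_sine p q (\<theta> t) * (exp (h p) * exp (h q))"
    using half_sine_evolution[OF K \<gamma> sol st] by blast
  define e where "e = exp (h j) * exp (h a) * exp (h b) * exp (h c)"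
  have "cross_ratio j a b c (\<theta> s) = (half_sine j a (\<theta> t) * half_sine b c (\<theta> t) * e)
      / (half_sine j b (\<theta> t) * half_sine a c (\<theta> t) * e)"
    unfolding cross_ratio_def by (simp add: h mem e_def mult_ac)
  \<comment> \<open>Cancellation needs only that \<open>e\<close> is nonzero; at a collision in the
    denominator both quotients are 0 by the convention for division.\<close>
  also have "\<dots> = cross_ratio j a b c (\<theta> t)"
    unfolding cross_ratio_def by (rule mult_divide_mult_cancel_right) (simp add: e_def)
  finally show "cross_ratio j a b c (\<theta> s) = cross_ratio j a b c (\<theta> t)" .
qed

section \<open>The dense open set of configurations without colliding phases, and cross-ratio
  gradients on it\<close>

definition no_collision :: "(real ^ 'n::finite) set" where
  "no_collision = {x. \<forall>j k. j \<noteq> k \<longrightarrow> half_sine j k x \<noteq> 0}"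

lemma continuous_on_half_sine: "continuous_on S (half_sine j k)"
  unfolding half_sine_def[abs_def] by (intro continuous_intros) simp

lemma no_collision_eq_Inter:
  "no_collision = \<Inter> ((\<lambda>(j, k). {x. half_sine j k x \<noteq> 0}) ` {(j, k). j \<noteq> k})"
  by (auto simp: no_collision_def)

lemma open_half_sine_nonzero: "open {x. half_sine j k x \<noteq> 0}"
  by (intro open_Collect_neq continuous_on_half_sine continuous_on_const)

lemma open_no_collision: "open (no_collision :: (real ^ 'n::finite) set)"
  unfolding no_collision_eq_Inter
  by (intro open_INT) (auto intro: open_half_sine_nonzero)

lemma closure_half_sine_nonzero:
  fixes j k :: "'n::finite"
  assumes "j \<noteq> k"
  shows "closure {x. half_sine j k x \<noteq> 0} = UNIV"
proof -
  have "\<exists>y\<in>{x. half_sine j k x \<noteq> 0}. dist y x < e" if "e > 0" for x :: "real ^ 'n" and e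
  proof (cases "half_sine j k x = 0")
    case False
    then show ?thesis using \<open>e > 0\<close> by (intro bexI[of _ x]) auto
  next
    case True
    \<comment> \<open>Moving phase \<open>j\<close> by \<open>d\<close> changes the sine from 0 to a
      cosine of modulus 1 times \<open>sin (d / 2)\<close>; the bound 1 keeps \<open>d / 2\<close>
      below \<pi>, where the sine is positive.\<close>
    define d where "d = min (e / 2) 1"
    define y where "y = x + d *\<^sub>R axis j 1"
    have d: "0 < d" "d \<le> 1" "d < e" using \<open>e > 0\<close> by (auto simp: d_def)
    have "(y $ j - y $ k) / 2 = (x $ j - x $ k) / 2 + d / 2"
      using assms by (simp add: y_def axis_def field_simps)
    then have "half_sine j k y = sin ((x $ j - x $ k) / 2 + d / 2)"
      by (simp only: half_sine_def)
    also have "\<dots> = cos ((x $ j - x $ k) / 2) * sin (d / 2)"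
      using True by (simp add: half_sine_def sin_add)
    finally have "half_sine j k y = cos ((x $ j - x $ k) / 2) * sin (d / 2)" .
    moreover have "cos ((x $ j - x $ k) / 2) \<noteq> 0"
      using True sin_cos_squared_add[of "(x $ j - x $ k) / 2"] by (auto simp: half_sine_def)
    moreover have "sin (d / 2) > 0"
      using d pi_gt3 by (intro sin_gt_zero) auto
    ultimately have "half_sine j k y \<noteq> 0" by simp
    moreover have "dist y x < e" using d by (simp add: y_def dist_norm norm_axis_1)
    ultimately show ?thesis by blast
  qed
  then show ?thesis by (auto simp: closure_approachable)
qed

text \<open>The set is a finite intersection of open dense sets, one for each pair of vertices, and
  Baire's theorem applies.\<close>

lemma closure_no_collision: "closure (no_collision :: (real ^ 'n::finite) set) = UNIV"
proof -
  have "UNIV \<subseteq> closure (\<Inter> ((\<lambda>(j, k). {x. half_sine j k x \<noteq> 0}) ` {(j, k :: 'n). j \<noteq> k}))"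
    by (rule Baire) (auto simp: closure_half_sine_nonzero open_half_sine_nonzero intro: countable_finite)
  then show ?thesis unfolding no_collision_eq_Inter by blast
qed

lemma GDERIV_half_sine:
  "GDERIV (half_sine j k) x :> (cos ((x $ j - x $ k) / 2) / 2) *\<^sub>R (axis j 1 - axis k 1)"
proof -
  have nth: "GDERIV (\<lambda>x. x $ j) x :> axis j 1" for j and x :: "real ^ 'n"
    unfolding gderiv_def
    using bounded_linear_imp_has_derivative[OF bounded_linear_vec_nth[of j]] by (simp add: inner_axis)
  have "DERIV (\<lambda>y. sin (y / 2)) (x $ j - x $ k) :> cos ((x $ j - x $ k) / 2) / 2"
    by (auto intro!: derivative_eq_intros)
  from GDERIV_DERIV_compose[OF GDERIV_diff[OF nth nth] this] show ?thesis
    unfolding half_sine_def[abs_def] .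
qed

text \<open>The derivative in the direction of the moving vertex \<open>j\<close> simplifies to a
  product of sines between the three base vertices over a square, so it cannot vanish without a
  collision.\<close>

lemma cross_ratio_gradient:
  fixes j a b c :: "'n::finite"
  assumes dist: "distinct [j, a, b, c]"
  shows "\<exists>g. continuous_on no_collision g \<and> (\<forall>x\<in>no_collision.
    (GDERIV (cross_ratio j a b c) x :> g x) \<and> g x $ j \<noteq> 0 \<and> (\<forall>i. i \<notin> {j, a, b, c} \<longrightarrow> g x $ i = 0))"
proof -
  define C where "C p q x = cos ((x $ p - x $ q) / 2) / 2" for p q and x :: "real ^ 'n"
  define G :: "'n \<Rightarrow> 'n \<Rightarrow> real ^ 'n \<Rightarrow> real ^ 'n" where "G p q x = C p q x *\<^sub>R (axis p 1 - axis q 1)" for p q x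
  define D where "D x = half_sine j b x * half_sine a c x" for x
  \<comment> \<open>The formula has exactly the shape that the product and inverse rules for
    gradients produce.\<close>
  define g where "g x = (half_sine j a x * half_sine b c x) *\<^sub>R (- (inverse (D x))\<^sup>2 *\<^sub>R
        (half_sine j b x *\<^sub>R G a c x + half_sine a c x *\<^sub>R G j b x))
      + inverse (D x) *\<^sub>R (half_sine j a x *\<^sub>R G b c x + half_sine b c x *\<^sub>R G j a x)" for x
  have G: "GDERIV (half_sine p q) x :> G p q x" for p q x
    unfolding G_def C_def by (rule GDERIV_half_sine)
  have D0: "D x \<noteq> 0" if "x \<in> no_collision" for x
    using that dist by (auto simp: no_collision_def D_def)
  have "GDERIV (cross_ratio j a b c) x :> g x" if x: "x \<in> no_collision" for x
  proof -
    have "GDERIV (\<lambda>x. (half_sine j a x * half_sine b c x) * inverse (D x)) x :> g x"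
      unfolding g_def using D0[OF x] unfolding D_def
      by (intro GDERIV_mult GDERIV_inverse G) auto
    then show ?thesis by (simp add: cross_ratio_def[abs_def] divide_inverse D_def)
  qed
  moreover have "g x $ j \<noteq> 0" if x: "x \<in> no_collision" for x
  proof -
    \<comment> \<open>Writing the difference of \<open>a\<close> and \<open>b\<close> through
      \<open>j\<close> yields the combination of sines and cosines that the quotient rule leaves in
      the \<open>j\<close> component.\<close>
    have "half_sine a b x = sin ((x $ j - x $ b) / 2 - (x $ j - x $ a) / 2)"
      by (simp add: half_sine_def diff_divide_distrib)
    then have sin: "half_sine a b x = 2 * (half_sine j b x * C j a x - C j b x * half_sine j a x)"
      by (simp add: half_sine_def C_def sin_diff)
    have "g x $ j = inverse (D x) * (half_sine b c x * C j a x)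
        - half_sine j a x * half_sine b c x * (inverse (D x))\<^sup>2 * (half_sine a c x * C j b x)"
      using dist by (simp add: g_def G_def axis_def)
    also have "\<dots> = half_sine b c x * half_sine a c x * half_sine a b x / (2 * (D x)\<^sup>2)"
      using D0[OF x] unfolding sin by (simp add: D_def field_simps power2_eq_square)
    finally show ?thesis
      using x dist D0[OF x] by (auto simp: no_collision_def)
  qed
  moreover have "g x $ i = 0" if "i \<notin> {j, a, b, c}" for x i
    using that by (simp add: g_def G_def axis_def)
  moreover have "continuous_on no_collision g"
  proof -
    have "continuous_on no_collision (G p q)" for p q
      unfolding G_def[abs_def] C_def by (intro continuous_intros) auto
    then show ?thesis
      using D0 unfolding g_def[abs_def] D_def
      by (intro continuous_intros continuous_on_half_sine) auto
  qed
  ultimately show ?thesis by (intro exI[of _ g]) auto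
qed

section \<open>Functional independence\<close>

text \<open>Each constant of motion gets a pivot vertex, at which its own partial derivative does not
  vanish while those of the others do.\<close>

lemma functionally_independent_pivots:
  fixes U :: "(real ^ 'n::finite) set"
  assumes U: "open U" "closure U = UNIV"
    and pivot: "\<And>j. j \<in> J \<Longrightarrow> \<exists>F g. P F \<and> continuous_on U g \<and> (\<forall>x\<in>U. (GDERIV F x :> g x) \<and>
      g x $ j \<noteq> 0 \<and> (\<forall>i\<in>J - {j}. g x $ i = 0))"
  shows "\<exists>f. (\<forall>i<card J. P (f i)) \<and> functionally_independent (card J) f"
proof -
  obtain F g where F: "\<And>j. j \<in> J \<Longrightarrow> P (F j) \<and> continuous_on U (g j) \<and> (\<forall>x\<in>U. (GDERIV (F j) x :> g j x) \<and>
      g j x $ j \<noteq> 0 \<and> (\<forall>i\<in>J - {j}. g j x $ i = 0))"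
    using pivot by metis
  obtain h where h: "bij_betw h {..<card J} J"
    using ex_bij_betw_nat_finite[of J] by (auto simp: atLeast0LessThan)
  have hJ: "h i \<in> J" if "i < card J" for i using h that by (auto simp: bij_betw_def)
  have "a i = 0"
    if x: "x \<in> U" and sum: "(\<Sum>i<card J. a i *\<^sub>R g (h i) x) = 0" and i: "i < card J" for x i and a :: "nat \<Rightarrow> real"
  proof -
    have "0 = (\<Sum>k<card J. a k *\<^sub>R g (h k) x) $ h i" by (simp add: sum)
    also have "\<dots> = (\<Sum>k<card J. a k * g (h k) x $ h i)" by simp
    also have "\<dots> = (\<Sum>k<card J. if k = i then a i * g (h i) x $ h i else 0)"
    proof (intro sum.cong refl)
      fix k assume k: "k \<in> {..<card J}"
      have "h i \<noteq> h k" if "k \<noteq> i"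
        using h k i that by (auto simp: bij_betw_def inj_on_def)
      then show "a k * g (h k) x $ h i = (if k = i then a i * g (h i) x $ h i else 0)"
        using F[OF hJ[of k]] hJ[of i] x k i by auto
    qed
    also have "\<dots> = a i * g (h i) x $ h i" using i by simp
    finally show "a i = 0" using F[OF hJ[OF i]] x by auto
  qed
  then have "functionally_independent (card J) (\<lambda>i. F (h i))"
    unfolding functionally_independent_def
    using U F hJ by (intro exI[of _ U] exI[of _ "\<lambda>i. g (h i)"]) auto
  then show ?thesis using F hJ by (intro exI[of _ "\<lambda>i. F (h i)"]) auto
qed

text \<open>Every monomial part other than a reference part \<sigma> gives one linear constant, with
  pivot at its maximum. In each cross-ratio part three base vertices are fixed, and every other
  vertex gives the cross-ratio with them, with itself as pivot; this accounts for subtracting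
  3.\<close>

theorem independent_constants_of_motion:
  fixes K :: "('n::{finite,linorder}, 'x) kuramoto_scheme"
  assumes K: "partitioned_kuramoto K"
    and nondegenerate: "num_M K \<ge> 2 \<Longrightarrow> \<exists>\<tau>\<in>{1..num_M K}. omega_tilde K \<tau> \<noteq> 0"
    and q: "q = (num_M K - 1) + (\<Sum>\<gamma>\<in>{1..num_C K}. card (part_C K \<gamma>) - 3)"
  shows "\<exists>f. (\<forall>i<q. constant_of_motion K (f i)) \<and> functionally_independent q f"
proof -
  note p = is_partitionD[OF K]
  \<comment> \<open>Both properties are guarded by the number of monomial parts, so that one choice
    covers all cases. With a single part the choice 1 leaves no other part to compare.\<close>
  obtain \<sigma> where \<sigma>: "num_M K \<ge> 1 \<Longrightarrow> \<sigma> \<in> {1..num_M K}" "num_M K \<ge> 2 \<Longrightarrow> omega_tilde K \<sigma> \<noteq> 0"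
  proof (cases "num_M K \<ge> 2")
    case True
    then show thesis using nondegenerate that by auto
  next
    case False
    then show thesis by (intro that[of 1]) auto
  qed
  have "\<exists>B. B \<subseteq> part_C K \<gamma> \<and> card B = 3" if "\<gamma> \<in> {1..num_C K}" for \<gamma>
    using obtain_subset_with_card_n[of 3 "part_C K \<gamma>"] p(8)[OF that] by fastforce
  then obtain B where B: "\<And>\<gamma>. \<gamma> \<in> {1..num_C K} \<Longrightarrow> B \<gamma> \<subseteq> part_C K \<gamma> \<and> card (B \<gamma>) = 3"
    by metis
  define JM where "JM = j_max K ` ({1..num_M K} - {\<sigma>})"
  define JC where "JC = (\<Union>\<gamma>\<in>{1..num_C K}. part_C K \<gamma> - B \<gamma>)"
  have JM_sub: "JM \<subseteq> all_M K"
    using j_max_in_part_M[OF K] part_M_subset_all_M unfolding JM_def by blast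
  have disj: "all_M K \<inter> JC = {}" using p(4) unfolding JC_def by blast
  have "card JM = card ({1..num_M K} - {\<sigma>})"
    unfolding JM_def using inj_on_j_max[OF K] by (intro card_image) (auto intro: inj_on_subset)
  \<comment> \<open>Without monomial parts the index set is empty and truncated subtraction gives 0
    as well.\<close>
  also have "\<dots> = num_M K - 1"
    using \<sigma>(1) by (cases "num_M K = 0") auto
  finally have "card JM = num_M K - 1" .
  moreover have "card JC = (\<Sum>\<gamma>\<in>{1..num_C K}. card (part_C K \<gamma> - B \<gamma>))"
    unfolding JC_def
  proof (rule card_UN_disjoint)
    show "\<forall>i\<in>{1..num_C K}. \<forall>j\<in>{1..num_C K}. i \<noteq> j \<longrightarrow> (part_C K i - B i) \<inter> (part_C K j - B j) = {}"
      using p(3) unfolding disjoint_family_on_def by blast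
  qed auto
  then have "card JC = (\<Sum>\<gamma>\<in>{1..num_C K}. card (part_C K \<gamma>) - 3)"
    using B by (simp add: card_Diff_subset)
  moreover have "card (JM \<union> JC) = card JM + card JC"
    using JM_sub disj by (intro card_Un_disjoint) auto
  ultimately have card: "card (JM \<union> JC) = q" by (simp add: q)
  have "\<exists>f. (\<forall>i<card (JM \<union> JC). constant_of_motion K (f i)) \<and> functionally_independent (card (JM \<union> JC)) f"
  proof (rule functionally_independent_pivots[OF open_no_collision closure_no_collision])
    fix j assume "j \<in> JM \<union> JC"
    then show "\<exists>F g. constant_of_motion K F \<and> continuous_on no_collision g \<and>
      (\<forall>x\<in>no_collision. (GDERIV F x :> g x) \<and> g x $ j \<noteq> 0 \<and> (\<forall>i\<in>JM \<union> JC - {j}. g x $ i = 0))"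
    proof
      assume "j \<in> JM"
      then obtain \<tau> where \<tau>: "\<tau> \<in> {1..num_M K}" "\<tau> \<noteq> \<sigma>" "j = j_max K \<tau>"
        unfolding JM_def by blast
      then have m1: "num_M K \<ge> 1" by auto
      have \<sigma>_mem: "\<sigma> \<in> {1..num_M K}" using \<sigma>(1)[OF m1] .
      have "num_M K \<ge> 2" using \<tau>(1,2) \<sigma>_mem by auto
      then have \<omega>: "omega_tilde K \<sigma> \<noteq> 0" by (rule \<sigma>(2))
      define v where "v = omega_tilde K \<sigma> *\<^sub>R mu_vec K \<tau> - omega_tilde K \<tau> *\<^sub>R mu_vec K \<sigma>"
      have j: "j \<in> part_M K \<tau>" using j_max_in_part_M[OF K \<tau>(1)] \<tau>(3) by simp
      then have "j \<notin> part_M K \<sigma>" using part_M_unique[OF K \<tau>(1) \<sigma>_mem] \<tau>(2) by blast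
      moreover have "mu_coef K \<tau> j \<noteq> 0"
        using K \<tau>(1) j unfolding partitioned_kuramoto_def by blast
      ultimately have "v $ j \<noteq> 0" using j \<omega> by (simp add: v_def mu_vec_def)
      \<comment> \<open>\<open>v\<close> is supported on the parts \<tau> and \<sigma>. The first
        contains no pivot except \<open>j\<close>, the second none at all because \<open>JM\<close>
        omits the maximum of the reference part.\<close>
      moreover have "v $ i = 0" if "i \<in> JM \<union> JC - {j}" for i
      proof -
        have "i \<notin> part_M K \<tau>"
          using that
        proof (elim DiffE UnE)
          assume "i \<in> JM" "i \<notin> {j}"
          then obtain \<rho> where \<rho>: "\<rho> \<in> {1..num_M K}" "i = j_max K \<rho>" "\<rho> \<noteq> \<tau>" unfolding JM_def \<tau>(3) by blast
          then show ?thesis using j_max_in_part_M[OF K \<rho>(1)] part_M_unique[OF K \<rho>(1) \<tau>(1)] by blast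
        next
          assume "i \<in> JC"
          then show ?thesis using disj part_M_subset_all_M[OF \<tau>(1)] by blast
        qed
        moreover have "i \<notin> part_M K \<sigma>"
          using that
        proof (elim DiffE UnE)
          assume "i \<in> JM"
          then obtain \<rho> where \<rho>: "\<rho> \<in> {1..num_M K}" "i = j_max K \<rho>" "\<rho> \<noteq> \<sigma>" unfolding JM_def by blast
          then show ?thesis using j_max_in_part_M[OF K \<rho>(1)] part_M_unique[OF K \<rho>(1) \<sigma>_mem] by blast
        next
          assume "i \<in> JC"
          then show ?thesis using disj part_M_subset_all_M[OF \<sigma>_mem] by blast
        qed
        ultimately show ?thesis by (simp add: v_def mu_vec_def)
      qed
      moreover have "GDERIV (\<lambda>x. v \<bullet> x) x :> v" for x
        unfolding gderiv_def
        using bounded_linear_imp_has_derivative[OF bounded_linear_inner_right[of v]] by (simp add: inner_commute[of _ v])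
      moreover have "constant_of_motion K (\<lambda>x. v \<bullet> x)"
        unfolding v_def by (rule mu_combination_constant[OF K \<tau>(1) \<sigma>_mem])
      ultimately show ?thesis
        by (intro exI[of _ "\<lambda>x. v \<bullet> x"] exI[of _ "\<lambda>_. v"] conjI) auto
    next
      assume "j \<in> JC"
      then obtain \<gamma> where \<gamma>: "\<gamma> \<in> {1..num_C K}" and j: "j \<in> part_C K \<gamma>" "j \<notin> B \<gamma>"
        by (auto simp: JC_def)
      have B\<gamma>: "B \<gamma> \<subseteq> part_C K \<gamma>" "card (B \<gamma>) = 3" using B[OF \<gamma>] by auto
      then obtain a b c where abc: "B \<gamma> = {a, b, c}" "distinct [a, b, c]"
        by (auto simp: card_3_iff)
      have "distinct [j, a, b, c]" using abc j by auto
      from cross_ratio_gradient[OF this] obtain g where g: "continuous_on no_collision g"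
        "\<And>x. x \<in> no_collision \<Longrightarrow> (GDERIV (cross_ratio j a b c) x :> g x) \<and> g x $ j \<noteq> 0 \<and>
          (\<forall>i. i \<notin> {j, a, b, c} \<longrightarrow> g x $ i = 0)" by blast
      \<comment> \<open>Base vertices are never pivots: \<open>JC\<close> removes them from their
        own part, and all other parts are disjoint from it.\<close>
      have notin: "i \<notin> {j, a, b, c}" if i: "i \<in> JM \<union> JC - {j}" for i
      proof -
        have "i \<notin> B \<gamma>"
          using i
        proof (elim DiffE UnE)
          assume "i \<in> JM"
          then show ?thesis using JM_sub p(4) B\<gamma>(1) \<gamma> by blast
        next
          assume "i \<in> JC"
          then obtain \<delta> where \<delta>: "\<delta> \<in> {1..num_C K}" "i \<in> part_C K \<delta>" "i \<notin> B \<delta>"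
            unfolding JC_def by blast
          show ?thesis
          proof (cases "\<delta> = \<gamma>")
            case True
            with \<delta>(3) show ?thesis by simp
          next
            case False
            then have "part_C K \<delta> \<inter> part_C K \<gamma> = {}"
              using p(3) \<delta>(1) \<gamma> by (simp add: disjoint_family_on_def)
            with \<delta>(2) B\<gamma>(1) show ?thesis by blast
          qed
        qed
        then show ?thesis using i abc(1) by auto
      qed
      have "constant_of_motion K (cross_ratio j a b c)"
        using abc B\<gamma> j by (intro cross_ratio_constant[OF K \<gamma>]) auto
      moreover have "(GDERIV (cross_ratio j a b c) x :> g x) \<and> g x $ j \<noteq> 0 \<and>
          (\<forall>i\<in>JM \<union> JC - {j}. g x $ i = 0)" if "x \<in> no_collision" for x
        using g(2)[OF that] notin by metis
      ultimately show ?thesis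
        using g(1) by (intro exI[of _ "cross_ratio j a b c"] exI[of _ g] conjI ballI; blast)
    qed
  qed
  then show ?thesis unfolding card .
qed

section \<open>Dimension count\<close>

lemma card_all_M:
  assumes K: "partitioned_kuramoto K"
  shows "card (all_M K) = (\<Sum>\<tau>\<in>{1..num_M K}. card (part_M K \<tau>))"
  unfolding all_M_def
  using is_partitionD(2)[OF K] by (intro card_UN_disjoint) (auto simp: disjoint_family_on_def)

lemma CARD_eq_sum_parts:
  fixes K :: "('n::{finite,linorder}, 'x) kuramoto_scheme"
  assumes K: "partitioned_kuramoto K"
  shows "CARD('n) = (\<Sum>\<tau>\<in>{1..num_M K}. card (part_M K \<tau>))
    + (\<Sum>\<gamma>\<in>{1..num_C K}. card (part_C K \<gamma>)) + card (part_P K)"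
proof -
  note p = is_partitionD[OF K]
  let ?C = "\<Union>\<gamma>\<in>{1..num_C K}. part_C K \<gamma>"
  have "CARD('n) = card (all_M K \<union> ?C \<union> part_P K)" unfolding p(1) ..
  also have "\<dots> = card (all_M K \<union> ?C) + card (part_P K)"
    using p(5,6) by (intro card_Un_disjoint) auto
  also have "card (all_M K \<union> ?C) = card (all_M K) + card ?C"
    using p(4) by (intro card_Un_disjoint) auto
  also have "card ?C = (\<Sum>\<gamma>\<in>{1..num_C K}. card (part_C K \<gamma>))"
    using p(3) by (intro card_UN_disjoint) (auto simp: disjoint_family_on_def)
  finally show ?thesis by (simp add: card_all_M[OF K])
qed

lemma card_kept_M:
  assumes K: "partitioned_kuramoto K"
  shows "card (kept_M K) = (\<Sum>\<tau>\<in>{1..num_M K}. card (part_M K \<tau>)) - (num_M K - 1)"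
proof -
  have "card (elim_M K) = num_M K - 1"
  proof -
    have "inj_on (j_max K) {1..<num_M K}"
      using inj_on_j_max[OF K] by (rule inj_on_subset) auto
    then show ?thesis by (simp add: elim_M_def card_image)
  qed
  then show ?thesis
    unfolding kept_M_def using elim_M_subset_all_M[OF K] by (simp add: card_Diff_subset card_all_M[OF K])
qed

text \<open>The lower bounds 1 and 4 on the sizes of the parts make the truncated subtractions
  exact. The last monomial part appears separately because it keeps its maximum.\<close>

lemma sum_card_parts:
  assumes K: "partitioned_kuramoto K"
  shows "(\<Sum>\<tau>\<in>{1..num_M K}. card (part_M K \<tau>))
      = (if num_M K = 0 then 0 else (\<Sum>\<tau>\<in>{1..<num_M K}. card (part_M K \<tau>) - 1) + card (part_M K (num_M K)))
        + (num_M K - 1)"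
    and "(\<Sum>\<gamma>\<in>{1..num_C K}. card (part_C K \<gamma>))
      = 3 * num_C K + (\<Sum>\<gamma>\<in>{1..num_C K}. card (part_C K \<gamma>) - 3)"
proof -
  note p = is_partitionD[OF K]
  have "(\<Sum>\<tau>\<in>{1..<num_M K}. card (part_M K \<tau>)) = (\<Sum>\<tau>\<in>{1..<num_M K}. (card (part_M K \<tau>) - 1) + 1)"
    using p(7) by (intro sum.cong refl) fastforce
  moreover have "{1..num_M K} = insert (num_M K) {1..<num_M K}" if "num_M K \<noteq> 0"
    using that by auto
  ultimately show "(\<Sum>\<tau>\<in>{1..num_M K}. card (part_M K \<tau>))
      = (if num_M K = 0 then 0 else (\<Sum>\<tau>\<in>{1..<num_M K}. card (part_M K \<tau>) - 1) + card (part_M K (num_M K)))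
        + (num_M K - 1)"
    by (cases "num_M K = 0") (simp_all add: sum.distrib add_ac del: One_nat_def)
  have "(\<Sum>\<gamma>\<in>{1..num_C K}. card (part_C K \<gamma>)) = (\<Sum>\<gamma>\<in>{1..num_C K}. 3 + (card (part_C K \<gamma>) - 3))"
    using p(8) by (intro sum.cong refl) fastforce
  then show "(\<Sum>\<gamma>\<in>{1..num_C K}. card (part_C K \<gamma>))
      = 3 * num_C K + (\<Sum>\<gamma>\<in>{1..num_C K}. card (part_C K \<gamma>) - 3)"
    by (simp add: sum.distrib)
qed

section \<open>The reduction\<close>

text \<open>Along the given solution the mean field is a known continuous function of time, so the
  equations for \<open>Z\<close> and \<open>\<zeta>\<close> of one part can be solved on their own,
  although in the reduced system they are coupled to everything else.\<close>

lemma moebius_reduction: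
  assumes K: "partitioned_kuramoto K" and sol: "kuramoto_solution K T \<theta>" and T0: "0 \<in> T"
    and \<gamma>: "\<gamma> \<in> {1..num_C K}"
    and init: "norm Z0 < 1" "norm \<zeta>0 = 1" "\<forall>j\<in>part_C K \<gamma>. norm (w j) = 1 \<and> cis (\<theta> 0 $ j) = disk_moebius Z0 \<zeta>0 (w j)"
  shows "\<exists>Z \<zeta>. Z 0 = Z0 \<and> \<zeta> 0 = \<zeta>0 \<and> (\<forall>t\<in>T. norm (Z t) < 1 \<and> norm (\<zeta> t) = 1 \<and>
    (\<forall>j\<in>part_C K \<gamma>. cis (\<theta> t $ j) = disk_moebius (Z t) (\<zeta> t) (w j)) \<and>
    (let F = mean_field (calA K \<gamma>) (\<theta> t); i\<Omega> = \<i> * of_real (Omega K \<gamma>) in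
      (Z has_vector_derivative F + i\<Omega> * Z t - cnj F * (Z t)\<^sup>2) (at t) \<and>
      (\<zeta> has_vector_derivative (i\<Omega> + F * cnj (Z t) - cnj F * Z t) * \<zeta> t) (at t)))"
proof -
  have T: "open T" "is_interval T" using sol by (auto simp: kuramoto_solution_def)
  define F where "F t = mean_field (calA K \<gamma>) (\<theta> t)" for t
  have F: "continuous_on T F"
    unfolding F_def by (rule mean_field_continuous_on[OF sol])
  obtain Z \<zeta> where Z0: "Z 0 = Z0" "\<zeta> 0 = \<zeta>0"
    and norms: "\<And>t. t \<in> T \<Longrightarrow> norm (Z t) < 1" "\<And>t. t \<in> T \<Longrightarrow> norm (\<zeta> t) = 1"
    and Z: "\<And>t. t \<in> T \<Longrightarrow>
      (Z has_vector_derivative F t + \<i> * of_real (Omega K \<gamma>) * Z t - cnj (F t) * (Z t)\<^sup>2) (at t)"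
    and \<zeta>: "\<And>t. t \<in> T \<Longrightarrow> (\<zeta> has_vector_derivative
      (\<i> * of_real (Omega K \<gamma>) + F t * cnj (Z t) - cnj (F t) * Z t) * \<zeta> t) (at t)"
    using moebius_parameters_exist[OF T T0 F init(1,2), of "Omega K \<gamma>"] by blast
  have "cis (\<theta> t $ j) = disk_moebius (Z t) (\<zeta> t) (w j)" if j: "j \<in> part_C K \<gamma>" and t: "t \<in> T" for j t
  proof (rule riccati_unique[OF T T0 t F continuous_on_cnj[OF F] continuous_on_const[of _ "\<i> * of_real (Omega K \<gamma>)"]])
    fix t assume t: "t \<in> T"
    show "((\<lambda>t. cis (\<theta> t $ j)) has_vector_derivative F t + \<i> * of_real (Omega K \<gamma>) * cis (\<theta> t $ j)
        - cnj (F t) * (cis (\<theta> t $ j))\<^sup>2) (at t)"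
      using has_vector_derivative_cis_of[OF kuramoto_solution_deriv[OF sol t, of j]]
      unfolding velocity_part_C[OF K \<gamma> j] rotation_eq_riccati F_def .
    show "((\<lambda>t. disk_moebius (Z t) (\<zeta> t) (w j)) has_vector_derivative F t
        + \<i> * of_real (Omega K \<gamma>) * disk_moebius (Z t) (\<zeta> t) (w j)
        - cnj (F t) * (disk_moebius (Z t) (\<zeta> t) (w j))\<^sup>2) (at t)"
    proof (rule disk_moebius_riccati[OF Z[OF t] \<zeta>[OF t]])
      have "norm (\<zeta> t * w j) \<le> 1" using norms(2)[OF t] init(3) j by (simp add: norm_mult)
      from norm_less_1_imp_moebius_denominator_nonzero[OF norms(1)[OF t] this]
      show "1 + \<zeta> t * cnj (Z t) * w j \<noteq> 0" by (simp add: mult_ac)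
    qed simp
  next
    show "cis (\<theta> 0 $ j) = disk_moebius (Z 0) (\<zeta> 0) (w j)" using init(3) j by (simp add: Z0)
  qed
  then show ?thesis
    using Z0 norms Z \<zeta> unfolding F_def Let_def by blast
qed

theorem kuramoto_reduction:
  fixes K :: "('n::{finite,linorder}, 'x) kuramoto_scheme"
  assumes K: "partitioned_kuramoto K" and sol: "kuramoto_solution K T \<theta>" and T0: "0 \<in> T"
    and Vi: "inverse_matrix_on (all_M K) (Vmat K) Vi"
    and init: "\<forall>\<gamma>\<in>{1..num_C K}. norm (Z0 \<gamma>) < 1 \<and> norm (\<zeta>0 \<gamma>) = 1 \<and>
      (\<forall>j\<in>part_C K \<gamma>. norm (w j) = 1 \<and> cis (\<theta> 0 $ j) = disk_moebius (Z0 \<gamma>) (\<zeta>0 \<gamma>) (w j))"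
  shows "\<exists>Z \<zeta>.
    (\<forall>\<gamma>\<in>{1..num_C K}. Z 0 \<gamma> = Z0 \<gamma> \<and> \<zeta> 0 \<gamma> = \<zeta>0 \<gamma>) \<and>
    (\<forall>t\<in>T. \<forall>\<gamma>\<in>{1..num_C K}. norm (Z t \<gamma>) < 1 \<and> norm (\<zeta> t \<gamma>) = 1 \<and>
      (\<forall>j\<in>part_C K \<gamma>. cis (\<theta> t $ j) = disk_moebius (Z t \<gamma>) (\<zeta> t \<gamma>) (w j))) \<and>
    reduced_solution K Vi (kappa0 K Vi (\<theta> 0)) w T (\<lambda>t. phi K (\<theta> t)) Z \<zeta> (\<lambda>t j. cis (\<theta> t $ j))"
proof -
  let ?F = "\<lambda>\<gamma> t. mean_field (calA K \<gamma>) (\<theta> t)" and ?i\<Omega> = "\<lambda>\<gamma>. \<i> * of_real (Omega K \<gamma>)"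
  have "\<forall>\<gamma>\<in>{1..num_C K}. \<exists>Z \<zeta>. Z 0 = Z0 \<gamma> \<and> \<zeta> 0 = \<zeta>0 \<gamma> \<and> (\<forall>t\<in>T. norm (Z t) < 1 \<and> norm (\<zeta> t) = 1 \<and>
    (\<forall>j\<in>part_C K \<gamma>. cis (\<theta> t $ j) = disk_moebius (Z t) (\<zeta> t) (w j)) \<and>
    (Z has_vector_derivative ?F \<gamma> t + ?i\<Omega> \<gamma> * Z t - cnj (?F \<gamma> t) * (Z t)\<^sup>2) (at t) \<and>
    (\<zeta> has_vector_derivative (?i\<Omega> \<gamma> + ?F \<gamma> t * cnj (Z t) - cnj (?F \<gamma> t) * Z t) * \<zeta> t) (at t))"
  proof
    fix \<gamma> assume \<gamma>: "\<gamma> \<in> {1..num_C K}"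
    with init have "norm (Z0 \<gamma>) < 1" "norm (\<zeta>0 \<gamma>) = 1"
      "\<forall>j\<in>part_C K \<gamma>. norm (w j) = 1 \<and> cis (\<theta> 0 $ j) = disk_moebius (Z0 \<gamma>) (\<zeta>0 \<gamma>) (w j)"
      by blast+
    from moebius_reduction[OF K sol T0 \<gamma> this, unfolded Let_def]
    show "\<exists>Z \<zeta>. Z 0 = Z0 \<gamma> \<and> \<zeta> 0 = \<zeta>0 \<gamma> \<and> (\<forall>t\<in>T. norm (Z t) < 1 \<and> norm (\<zeta> t) = 1 \<and>
      (\<forall>j\<in>part_C K \<gamma>. cis (\<theta> t $ j) = disk_moebius (Z t) (\<zeta> t) (w j)) \<and>
      (Z has_vector_derivative ?F \<gamma> t + ?i\<Omega> \<gamma> * Z t - cnj (?F \<gamma> t) * (Z t)\<^sup>2) (at t) \<and>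
      (\<zeta> has_vector_derivative (?i\<Omega> \<gamma> + ?F \<gamma> t * cnj (Z t) - cnj (?F \<gamma> t) * Z t) * \<zeta> t) (at t))" .
  qed
  then obtain Z' \<zeta>' where Z\<zeta>: "\<And>\<gamma>. \<gamma> \<in> {1..num_C K} \<Longrightarrow> Z' \<gamma> 0 = Z0 \<gamma> \<and> \<zeta>' \<gamma> 0 = \<zeta>0 \<gamma> \<and>
    (\<forall>t\<in>T. norm (Z' \<gamma> t) < 1 \<and> norm (\<zeta>' \<gamma> t) = 1 \<and>
    (\<forall>j\<in>part_C K \<gamma>. cis (\<theta> t $ j) = disk_moebius (Z' \<gamma> t) (\<zeta>' \<gamma> t) (w j)) \<and>
    (Z' \<gamma> has_vector_derivative ?F \<gamma> t + ?i\<Omega> \<gamma> * Z' \<gamma> t - cnj (?F \<gamma> t) * (Z' \<gamma> t)\<^sup>2) (at t) \<and>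
    (\<zeta>' \<gamma> has_vector_derivative
      (?i\<Omega> \<gamma> + ?F \<gamma> t * cnj (Z' \<gamma> t) - cnj (?F \<gamma> t) * Z' \<gamma> t) * \<zeta>' \<gamma> t) (at t))"
    unfolding bchoice_iff by blast
  \<comment> \<open>Choice produces a function of time for each part; the reduced state takes the
    time first.\<close>
  define Z \<zeta> where "Z t \<gamma> = Z' \<gamma> t" and "\<zeta> t \<gamma> = \<zeta>' \<gamma> t" for t \<gamma>
  let ?\<kappa>0 = "kappa0 K Vi (\<theta> 0)"
  have cis_deriv: "((\<lambda>s. cis (\<theta> s $ j)) has_vector_derivative
      \<i> * of_real (velocity K (\<theta> t) j) * cis (\<theta> t $ j)) (at t)" if "t \<in> T" for t j
    by (rule has_vector_derivative_cis_of[OF kuramoto_solution_deriv[OF sol that]])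
  have elim: "cis (\<theta> t $ j_max K \<eta>) = cis (?\<kappa>0 \<eta>) * xi_mono K Vi (phi K (\<theta> t)) \<eta>"
    if "\<eta> \<in> {1..<num_M K}" "t \<in> T" for \<eta> t
    by (rule cis_j_max[OF K sol that(1) Vi T0 that(2)])
  have coupling: "coupling K Vi ?\<kappa>0 w a (phi K (\<theta> t)) (Z t) (\<zeta> t) (\<lambda>k. cis (\<theta> t $ k))
      = mean_field a (\<theta> t)" if "t \<in> T" for a t
    by (rule coupling_eq_mean_field[OF K]) (use elim Z\<zeta> that in \<open>auto simp: Z_def \<zeta>_def\<close>)
  \<comment> \<open>Only the maxima of the parts before the last are eliminated, so the vertices of
    the last part all keep their own phase.\<close>
  have kept: "phi K x j = x $ j" if "\<tau> \<in> {1..num_M K}" "j \<in> part_M K \<tau>" "j \<noteq> j_max K \<tau> \<or> \<tau> = num_M K"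
    for \<tau> j x
  proof (rule phi_not_elim_M)
    show "j \<notin> elim_M K"
    proof
      assume "j \<in> elim_M K"
      then obtain \<eta> where \<eta>: "\<eta> \<in> {1..num_M K}" "\<eta> < num_M K" "j = j_max K \<eta>" by (auto simp: elim_M_def)
      then have "\<eta> = \<tau>" using part_M_unique[OF K \<eta>(1) that(1)] j_max_in_part_M[OF K \<eta>(1)] that(2) by simp
      with \<eta> that(3) show False by auto
    qed
  qed
  have mono: "((\<lambda>s. cis (phi K (\<theta> s) j)) has_vector_derivative mono_rhs K Vi ?\<kappa>0 (phi K (\<theta> t)) \<eta> j) (at t)"
    if t: "t \<in> T" and \<eta>: "\<eta> \<in> {1..<num_M K}" and j: "j \<in> part_M K \<eta> - {j_max K \<eta>}" for t \<eta> j
  proof -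
    let ?x = "\<theta> t" and ?j = "j_max K \<eta>"
    have \<eta>': "\<eta> \<in> {1..num_M K}" using \<eta> by auto
    define f where "f y k = of_real (S_coef K j k) *
        (y * cis (- kappa K j k) - cnj y * (cis (?x $ j))\<^sup>2 * cis (kappa K j k))" for y k
    have "\<i> * of_real (velocity K ?x j) * cis (?x $ j)
      = \<i> * of_real (freq K $ j) * cis (?x $ j)
        + 1 / (2 * of_real (mu_coef K \<eta> j)) * (\<Sum>k\<in>part_M K \<eta>. f (cis (?x $ k)) k)"
      unfolding f_def using j by (intro velocity_part_M_complex[OF K \<eta>']) auto
    \<comment> \<open>The term of the eliminated vertex is split off, since its phase factor has to
      be replaced by the constant times the monomial.\<close>
    also have "(\<Sum>k\<in>part_M K \<eta>. f (cis (?x $ k)) k)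
        = (\<Sum>k\<in>part_M K \<eta> - {?j}. f (cis (?x $ k)) k) + f (cis (?x $ ?j)) ?j"
      using j_max_in_part_M[OF K \<eta>'] by (simp add: sum.remove[of _ ?j])
    also have "(\<Sum>k\<in>part_M K \<eta> - {?j}. f (cis (?x $ k)) k) = (\<Sum>k\<in>part_M K \<eta> - {?j}. f (cis (phi K ?x k)) k)"
      using kept[OF \<eta>'] by (intro sum.cong refl) auto
    also have "f (cis (?x $ ?j)) ?j = of_real (S_coef K j ?j) *
        (xi_mono K Vi (phi K ?x) \<eta> * cis (?\<kappa>0 \<eta> - kappa K j ?j)
          - cnj (xi_mono K Vi (phi K ?x) \<eta>) * (cis (?x $ j))\<^sup>2 * cis (- (?\<kappa>0 \<eta> - kappa K j ?j)))"
    proof -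
      have "cis (?\<kappa>0 \<eta> - kappa K j ?j) = cis (?\<kappa>0 \<eta>) * cis (- kappa K j ?j)"
        "cis (- (?\<kappa>0 \<eta> - kappa K j ?j)) = cnj (cis (?\<kappa>0 \<eta>)) * cis (kappa K j ?j)"
        by (simp_all add: cis_mult cis_cnj)
      then show ?thesis
        unfolding f_def elim[OF \<eta> t] by (simp only: complex_cnj_mult mult_ac)
    qed
    finally have "\<i> * of_real (velocity K ?x j) * cis (?x $ j) = mono_rhs K Vi ?\<kappa>0 (phi K ?x) \<eta> j"
      using kept[OF \<eta>', of j] j
      by (simp add: mono_rhs_def Let_def f_def distrib_left mult.assoc)
    with cis_deriv[OF t, of j] show ?thesis
      using kept[OF \<eta>', of j] j by simp
  qed
  have mono_last: "((\<lambda>s. cis (phi K (\<theta> s) j)) has_vector_derivative mono_rhs_last K (phi K (\<theta> t)) j) (at t)"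
    if t: "t \<in> T" and m: "1 \<le> num_M K" and j: "j \<in> part_M K (num_M K)" for t j
  proof -
    have m': "num_M K \<in> {1..num_M K}" using m by auto
    have "\<i> * of_real (velocity K (\<theta> t) j) * cis (\<theta> t $ j) = mono_rhs_last K (phi K (\<theta> t)) j"
      unfolding velocity_part_M_complex[OF K m' j] mono_rhs_last_def Let_def
      using kept[OF m'] j by simp
    with cis_deriv[OF t, of j] show ?thesis using kept[OF m' j] by simp
  qed
  have W0: "weight K j j = 0" for j using K unfolding partitioned_kuramoto_def by (elim conjE) simp
  \<comment> \<open>The rotation rate is 0 here: the natural frequency already sits in the diagonal
    entry of \<open>Amat\<close>.\<close>
  have P: "((\<lambda>s. cis (\<theta> s $ j)) has_vector_derivative mean_field (Amat K j) (\<theta> t)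
      - cnj (mean_field (Amat K j) (\<theta> t)) * (cis (\<theta> t $ j))\<^sup>2) (at t)" if "t \<in> T" for t j
    using cis_deriv[OF that, of j] rotation_eq_riccati[of 0 "mean_field (Amat K j) (\<theta> t)" "\<theta> t $ j"]
    by (simp add: velocity_eq_Im_mean_field[of K j "\<theta> t", OF W0])
  have "reduced_solution K Vi ?\<kappa>0 w T (\<lambda>t. phi K (\<theta> t)) Z \<zeta> (\<lambda>t j. cis (\<theta> t $ j))"
    unfolding reduced_solution_def Let_def
  proof (intro ballI conjI impI)
    fix t \<gamma> assume t: "t \<in> T" and \<gamma>: "\<gamma> \<in> {1..num_C K}"
    show "((\<lambda>s. Z s \<gamma>) has_vector_derivative
      coupling K Vi ?\<kappa>0 w (calA K \<gamma>) (phi K (\<theta> t)) (Z t) (\<zeta> t) (\<lambda>j. cis (\<theta> t $ j)) + ?i\<Omega> \<gamma> * Z t \<gamma>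
      - cnj (coupling K Vi ?\<kappa>0 w (calA K \<gamma>) (phi K (\<theta> t)) (Z t) (\<zeta> t) (\<lambda>j. cis (\<theta> t $ j))) * (Z t \<gamma>)\<^sup>2) (at t)"
      unfolding coupling[OF t] using Z\<zeta>[OF \<gamma>] t by (simp add: Z_def)
    show "((\<lambda>s. \<zeta> s \<gamma>) has_vector_derivative
      (?i\<Omega> \<gamma> + coupling K Vi ?\<kappa>0 w (calA K \<gamma>) (phi K (\<theta> t)) (Z t) (\<zeta> t) (\<lambda>j. cis (\<theta> t $ j)) * cnj (Z t \<gamma>)
      - cnj (coupling K Vi ?\<kappa>0 w (calA K \<gamma>) (phi K (\<theta> t)) (Z t) (\<zeta> t) (\<lambda>j. cis (\<theta> t $ j))) * Z t \<gamma>) * \<zeta> t \<gamma>) (at t)"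
      unfolding coupling[OF t] using Z\<zeta>[OF \<gamma>] t by (simp add: Z_def \<zeta>_def)
  qed (use mono mono_last P coupling in auto)
  moreover have "\<forall>\<gamma>\<in>{1..num_C K}. Z 0 \<gamma> = Z0 \<gamma> \<and> \<zeta> 0 \<gamma> = \<zeta>0 \<gamma>"
    using Z\<zeta> by (simp add: Z_def \<zeta>_def)
  moreover have "\<forall>t\<in>T. \<forall>\<gamma>\<in>{1..num_C K}. norm (Z t \<gamma>) < 1 \<and> norm (\<zeta> t \<gamma>) = 1 \<and>
      (\<forall>j\<in>part_C K \<gamma>. cis (\<theta> t $ j) = disk_moebius (Z t \<gamma>) (\<zeta> t \<gamma>) (w j))"
    using Z\<zeta> unfolding Z_def \<zeta>_def by blast
  ultimately show ?thesis by blast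
qed

text \<open>The conserved coordinates and the counts stand outside the quantifier over
  \<open>Vi\<close>, so they are also asserted when the coordinate matrix is singular.\<close>

theorem mainTheorem1:
  fixes K :: "'n::{finite,linorder} kuramoto"
  assumes model: "partitioned_kuramoto K"
    and nondegenerate: "num_M K \<ge> 2 \<Longrightarrow> \<exists>\<tau>\<in>{1..num_M K}. omega_tilde K \<tau> \<noteq> 0"
  shows
    "(\<forall>T \<theta>. kuramoto_solution K T \<theta> \<and> 0 \<in> T \<longrightarrow>
       (\<forall>\<eta>\<in>{1..<num_M K}. \<forall>t\<in>T.
          phi K (\<theta> t) (j_max K \<eta>) = nu K \<eta> \<bullet> \<theta> t \<and> nu K \<eta> \<bullet> \<theta> t = nu K \<eta> \<bullet> \<theta> 0) \<and>
       (\<forall>Vi w Z0 \<zeta>0.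
          inverse_matrix_on (all_M K) (Vmat K) Vi \<and>
          (\<forall>\<gamma>\<in>{1..num_C K}. norm (Z0 \<gamma>) < 1 \<and> norm (\<zeta>0 \<gamma>) = 1 \<and>
             (\<forall>j\<in>part_C K \<gamma>. norm (w j) = 1 \<and>
                cis (\<theta> 0 $ j) = disk_moebius (Z0 \<gamma>) (\<zeta>0 \<gamma>) (w j))) \<longrightarrow>
          (let \<kappa>0 = kappa0 K Vi (\<theta> 0); \<phi> = (\<lambda>t. phi K (\<theta> t)); z = (\<lambda>t j. cis (\<theta> t $ j)) in
           \<exists>Z \<zeta>.
             (\<forall>\<gamma>\<in>{1..num_C K}. Z 0 \<gamma> = Z0 \<gamma> \<and> \<zeta> 0 \<gamma> = \<zeta>0 \<gamma>) \<and>
             (\<forall>t\<in>T. \<forall>\<gamma>\<in>{1..num_C K}.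
                norm (Z t \<gamma>) < 1 \<and> norm (\<zeta> t \<gamma>) = 1 \<and>
                (\<forall>j\<in>part_C K \<gamma>. z t j = disk_moebius (Z t \<gamma>) (\<zeta> t \<gamma>) (w j))) \<and>
             (\<forall>t\<in>T. \<forall>\<eta>\<in>{1..<num_M K}.
                z t (j_max K \<eta>) = cis (\<kappa>0 \<eta>) * xi_mono K Vi (\<phi> t) \<eta>) \<and>
             (\<forall>t\<in>T. \<forall>j\<in>kept_M K. z t j = cis (\<phi> t j)) \<and>
             reduced_solution K Vi \<kappa>0 w T \<phi> Z \<zeta> z))) \<and>
     (let d = (\<lambda>\<tau>. card (part_M K \<tau>)); n\<^sub>C = (\<lambda>\<gamma>. card (part_C K \<gamma>));
          m = num_M K; c = num_C K; p = card (part_P K);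
          n = (if m = 0 then 0 else (\<Sum>\<tau>\<in>{1..<m}. d \<tau> - 1) + d m) + 3 * c + p;
          q = (m - 1) + (\<Sum>\<gamma>\<in>{1..c}. n\<^sub>C \<gamma> - 3)
      in CARD('n) = (\<Sum>\<tau>\<in>{1..m}. d \<tau>) + (\<Sum>\<gamma>\<in>{1..c}. n\<^sub>C \<gamma>) + p \<and>
         reduced_dim K = n \<and>
         CARD('n) = n + q \<and>
         (\<exists>f. (\<forall>i<q. constant_of_motion K (f i)) \<and> functionally_independent q f))"
  unfolding Let_def
proof (intro conjI allI impI ballI)
  fix T \<theta> \<eta> t
  assume sol: "kuramoto_solution K T \<theta> \<and> 0 \<in> T" and \<eta>: "\<eta> \<in> {1..<num_M K}" and t: "t \<in> T"
  show "phi K (\<theta> t) (j_max K \<eta>) = nu K \<eta> \<bullet> \<theta> t"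
    by (rule phi_j_max[OF model \<eta>])
  show "nu K \<eta> \<bullet> \<theta> t = nu K \<eta> \<bullet> \<theta> 0"
    by (rule nu_inner_constant[OF model _ \<eta> t]) (use sol in auto)
next
  fix T \<theta> Vi w Z0 \<zeta>0
  assume sol: "kuramoto_solution K T \<theta> \<and> 0 \<in> T"
    and init: "inverse_matrix_on (all_M K) (Vmat K) Vi \<and>
      (\<forall>\<gamma>\<in>{1..num_C K}. norm (Z0 \<gamma>) < 1 \<and> norm (\<zeta>0 \<gamma>) = 1 \<and>
        (\<forall>j\<in>part_C K \<gamma>. norm (w j) = 1 \<and> cis (\<theta> 0 $ j) = disk_moebius (Z0 \<gamma>) (\<zeta>0 \<gamma>) (w j)))"
  note red = kuramoto_reduction[OF model conjunct1[OF sol] conjunct2[OF sol] conjunct1[OF init] conjunct2[OF init]]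
  have elim: "\<forall>t\<in>T. \<forall>\<eta>\<in>{1..<num_M K}. cis (\<theta> t $ j_max K \<eta>)
      = cis (kappa0 K Vi (\<theta> 0) \<eta>) * xi_mono K Vi (phi K (\<theta> t)) \<eta>"
    using cis_j_max[OF model conjunct1[OF sol] _ conjunct1[OF init] conjunct2[OF sol]] by blast
  have kept: "\<forall>t\<in>T. \<forall>j\<in>kept_M K. cis (\<theta> t $ j) = cis (phi K (\<theta> t) j)"
    by (simp add: kept_M_def phi_not_elim_M)
  show "\<exists>Z \<zeta>.
    (\<forall>\<gamma>\<in>{1..num_C K}. Z 0 \<gamma> = Z0 \<gamma> \<and> \<zeta> 0 \<gamma> = \<zeta>0 \<gamma>) \<and>
    (\<forall>t\<in>T. \<forall>\<gamma>\<in>{1..num_C K}. norm (Z t \<gamma>) < 1 \<and> norm (\<zeta> t \<gamma>) = 1 \<and>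
      (\<forall>j\<in>part_C K \<gamma>. cis (\<theta> t $ j) = disk_moebius (Z t \<gamma>) (\<zeta> t \<gamma>) (w j))) \<and>
    (\<forall>t\<in>T. \<forall>\<eta>\<in>{1..<num_M K}. cis (\<theta> t $ j_max K \<eta>)
      = cis (kappa0 K Vi (\<theta> 0) \<eta>) * xi_mono K Vi (phi K (\<theta> t)) \<eta>) \<and>
    (\<forall>t\<in>T. \<forall>j\<in>kept_M K. cis (\<theta> t $ j) = cis (phi K (\<theta> t) j)) \<and>
    reduced_solution K Vi (kappa0 K Vi (\<theta> 0)) w T (\<lambda>t. phi K (\<theta> t)) Z \<zeta> (\<lambda>t j. cis (\<theta> t $ j))"
    using red elim kept by blast
next
  show "\<exists>f. (\<forall>i<num_M K - 1 + (\<Sum>\<gamma>\<in>{1..num_C K}. card (part_C K \<gamma>) - 3). constant_of_motion K (f i)) \<and>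
    functionally_independent (num_M K - 1 + (\<Sum>\<gamma>\<in>{1..num_C K}. card (part_C K \<gamma>) - 3)) f"
    by (rule independent_constants_of_motion[OF model nondegenerate refl])
next
  note parts = sum_card_parts[OF model]
  show "CARD('n) = (\<Sum>\<tau>\<in>{1..num_M K}. card (part_M K \<tau>))
    + (\<Sum>\<gamma>\<in>{1..num_C K}. card (part_C K \<gamma>)) + card (part_P K)"
    by (rule CARD_eq_sum_parts[OF model])
  then show "CARD('n) = (if num_M K = 0 then 0
      else (\<Sum>\<tau>\<in>{1..<num_M K}. card (part_M K \<tau>) - 1) + card (part_M K (num_M K)))
      + 3 * num_C K + card (part_P K)
      + (num_M K - 1 + (\<Sum>\<gamma>\<in>{1..num_C K}. card (part_C K \<gamma>) - 3))"
    unfolding parts by simp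
  show "reduced_dim K = (if num_M K = 0 then 0
      else (\<Sum>\<tau>\<in>{1..<num_M K}. card (part_M K \<tau>) - 1) + card (part_M K (num_M K)))
      + 3 * num_C K + card (part_P K)"
    unfolding reduced_dim_def card_kept_M[OF model] parts by simp
qed

end
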